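(* For every $\eta\in[1,2]$ one has $\mu_\eta\big(\big[-\frac12,\frac12\big]\big)\le\frac23$, and $\mu_\eta\big(\big[-\frac12,\frac12\big]\big)=\frac23$ if and only if $\eta\in\big[\frac65,\frac32\big]$. Equivalently, for every $\eta\in[1,2]$ the frequency of the digit $0$, $$\lim_{N\to\infty}\frac1N\#\{1\le n\le N: d_{\eta,n}(x)=0\},$$ in a typical signed binary expansion (that is, for Lebesgue almost every $x\in[-1,1]$) obtained from the map $S_\eta$ is at most $\frac23$, and this maximum $\frac23$ is obtained for typical expansions if and only if $\eta\in\big[\frac65,\frac32\big]$.
   Context: For $\eta\in[1,2]$ the symmetric doubling map $S_\eta:[-1,1]\to[-1,1]$ is $S_\eta(x)=2x-d_1(x)\eta$, where $d_1(x)=-1$ if $x<-\frac12$, $d_1(x)=0$ if $x\in[-\frac12,\frac12]$, and $d_1(x)=1$ if $x>\frac12$. For $n\ge1$ put $d_{\eta,n}(x)=d_1(S_\eta^{n-1}(x))$; then $x=\eta\sum_{n\ge1}d_{\eta,n}(x)2^{-n}$, and the sequence $(d_{\eta,n}(x))_{n\ge1}$ is the signed binary expansion of $x$ obtained from $S_\eta$. For $\eta\in(1,2]$, $\mu_\eta$ denotes the unique $S_\eta$-invariant Borel probability measure on $[-1,1]$ that is absolutely continuous with respect to Lebesgue measure. For $\eta=1$, $\mu_1$ is normalised Lebesgue measure on $[-1,1]$. *)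

theory Defs
  imports "HOL-Probability.Probability"
begin

definition d1 :: "real \<Rightarrow> int" where
  "d1 x = (if x < - 1/2 then -1 else if x \<le> 1/2 then 0 else 1)"

(* The symmetric doubling map.  The formula makes sense on all of the reals;
   for 1 <= eta <= 2 it maps [-1,1] into itself. *)
definition S :: "real \<Rightarrow> real \<Rightarrow> real" where
  "S \<eta> x = 2 * x - of_int (d1 x) * \<eta>"

(* Digits are indexed from n = 1; the value at n = 0 is never used. *)
definition digit :: "real \<Rightarrow> nat \<Rightarrow> real \<Rightarrow> int" where
  "digit \<eta> n x = d1 ((S \<eta> ^^ (n - 1)) x)"

definition zero_freq :: "real \<Rightarrow> real \<Rightarrow> nat \<Rightarrow> real" where
  "zero_freq \<eta> x N = real (card {n \<in> {1..N}. digit \<eta> n x = 0}) / real N"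

(* Lebesgue measure on the Borel sets of [-1,1], of total mass 2. *)
definition leb :: "real measure" where
  "leb = restrict_space lborel {-1..1}"

(* Fixing the sigma-algebra of M also fixes its space as [-1,1], so that two measures
   satisfying this predicate are equal as soon as they agree on Borel subsets of [-1,1]. *)
definition acip :: "real \<Rightarrow> real measure \<Rightarrow> bool" where
  "acip \<eta> M \<longleftrightarrow>
     sets M = sets (restrict_space borel {-1..1}) \<and>
     prob_space M \<and>
     absolutely_continuous leb M \<and>
     (\<forall>A\<in>sets M. emeasure M (S \<eta> -` A \<inter> space M) = emeasure M A)"

(* For eta = 1 the absolutely continuous invariant probability is not unique
   ([-1,0) and (0,1] are both invariant), hence the separate clause. *)
definition \<mu> :: "real \<Rightarrow> real measure" where
  "\<mu> \<eta> = (if \<eta> = 1 then uniform_measure leb {-1..1} else (THE M. acip \<eta> M))"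

end

theory Submission
  imports Defs
begin

text \<open>
  Everything rests on two observations about \<open>S \<eta>\<close>. Since \<open>S \<eta> x\<close> differs from \<open>2 * x\<close> by a multiple
  of \<open>\<eta>\<close>, the map is an extension of the doubling map on the circle of length \<open>\<eta>\<close>; for \<open>1 < \<eta>\<close> a
  point of the circle has at most two representatives \<open>x - \<eta>\<close> and \<open>x\<close> in \<open>[-1,1]\<close>. And two such
  representatives keep their distance \<open>\<eta>\<close> under iteration until the upper one enters
  \<open>(1/2, \<eta> - 1/2)\<close>; at the next step they coincide.

  Ergodicity. A Borel set with period \<open>\<eta>\<close> that doubling maps into itself is null or conull
  (\<open>doubling_invariant_trivial\<close>). Applied to the set of points whose doubling orbit never meets
  \<open>(1/2, \<eta> - 1/2)\<close>, this shows that almost all pairs of representatives coalesce. Applied to the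
  saturations modulo \<open>\<eta>\<close> of an \<open>S \<eta>\<close>-invariant set \<open>A\<close> and of its complement, it shows that if neither
  \<open>A\<close> nor the complement were null, then almost every circle point would have one representative in
  each; but these coalesce, which invariance forbids (\<open>S_ergodic\<close>). For \<open>\<eta> = 1\<close> there is no
  coalescence; there \<open>(0,1]\<close> carries the plain doubling map, and oddness of \<open>S 1\<close> transfers the
  frequency, which is \<open>1/2\<close>, to \<open>[-1,0)\<close>.

  The invariant measure. For a real \<open>t\<close> let \<open>g t\<close> be \<open>sgn t\<close> times the indicator of
  \<open>[-\<bar>t\<bar>, \<bar>t\<bar>]\<close>. The transfer operator \<open>L\<close> of \<open>S \<eta>\<close> satisfies
  \<open>L (g t) = (g (S \<eta> t) + d1 t * (g 1 - g (1 - \<eta>))) / 2\<close>. As \<open>t / \<eta>\<close> is the sum of the signed digits of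
  \<open>t\<close>, weighted by the powers of \<open>1/2\<close>, the function
  \<open>h = (\<Sum>n. (1/2)^n * (g (u n) - g (v n)))\<close>, with \<open>u n\<close> and \<open>v n\<close> the orbits of the two one-sided
  images \<open>1\<close> and \<open>1 - \<eta>\<close> of the discontinuity \<open>1/2\<close>, is fixed by \<open>L\<close>. Those orbits are again a pair at
  distance \<open>\<eta>\<close> or \<open>0\<close>, so every term is nonnegative and \<open>h\<close> is at least \<open>1\<close> on \<open>(-1,1]\<close>. Thus \<open>h\<close>
  normalises to an invariant probability equivalent to Lebesgue measure, and Birkhoff's theorem for it
  gives both the uniqueness that defines \<open>\<mu> \<eta>\<close> and the almost sure frequency of the digit \<open>0\<close>.

  The bound \<open>2/3\<close>. The sign of \<open>\<mu> \<eta> [-1/2,1/2] - 2/3\<close> is that of a series over the pair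
  \<open>(u n, v n)\<close>. Let \<open>s n = min (u n) (- v n)\<close>. Up to coalescence \<open>s\<close> follows the tent map
  \<open>min (2 * s) (\<eta> - 2 * s)\<close> with fixed point \<open>\<eta> / 3\<close>. For \<open>\<eta> \<le> 3/2\<close> an explicit potential, affine on either side
  of the fixed point, dominates the series termwise after telescoping, and vanishes at the start
  (\<open>potential_step\<close>). The only loss occurs at times with \<open>s n < \<eta> / 6\<close>, when two consecutive values lie below the
  fixed point. As \<open>s 0 = \<eta> - 1\<close> is the least value before coalescence, a loss occurs exactly for \<open>\<eta> < 6/5\<close>. For
  \<open>\<eta> > 3/2\<close> the pair coalesces after one step and the series is its first term, which is negative.
\<close>

section \<open>Periodic sets that are forward invariant under doubling\<close>

lemma emeasure_affine_vimage:
  fixes a b :: real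
  assumes "B \<in> sets borel" "a > 0"
  shows "emeasure lborel B = ennreal a * emeasure lborel {x. a * x + b \<in> B}"
proof -
  have "emeasure lborel B = emeasure (density (distr lborel borel (\<lambda>x. b + a * x)) (\<lambda>_. ennreal \<bar>a\<bar>)) B"
    by (rule arg_cong[OF lborel_real_affine, where f = "\<lambda>M. emeasure M B"]) (use assms in simp)
  also have "\<dots> = ennreal a * emeasure lborel ((\<lambda>x. b + a * x) -` B)"
    using assms by (simp add: emeasure_density nn_integral_cmult emeasure_distr)
  also have "(\<lambda>x. b + a * x) -` B = {x. a * x + b \<in> B}"
    by (auto simp: add.commute)
  finally show ?thesis .
qed

lemma borel_affine_vimage:
  fixes a b :: real
  assumes "B \<in> sets borel"
  shows "{x. a * x + b \<in> B} \<in> sets borel"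
  using measurable_sets[OF _ assms, of "\<lambda>x. a * x + b" borel] by (simp add: vimage_def)

lemma measure_affine_vimage:
  fixes a b :: real
  assumes "B \<in> sets borel" "a > 0"
  shows "measure lborel {x. a * x + b \<in> B} = measure lborel B / a"
  using emeasure_affine_vimage[OF assms, of b] assms(2)
  by (simp add: measure_def enn2real_mult)

lemma null_affine_vimage:
  fixes a b :: real
  assumes "B \<in> null_sets lborel" "a > 0"
  shows "{x. a * x + b \<in> B} \<in> null_sets lborel"
proof -
  have B: "B \<in> sets borel" using assms(1) by auto
  have "{x. a * x + b \<in> B} \<in> sets borel" by (rule borel_affine_vimage[OF B])
  then show ?thesis
    using emeasure_affine_vimage[OF B assms(2), of b] assms by (auto simp: null_sets_def)
qed

lemma measure_Ioc_split:
  fixes E :: "real set"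
  assumes "E \<in> sets borel" "a \<le> b" "b \<le> c"
  shows "measure lborel (E \<inter> {a<..c}) = measure lborel (E \<inter> {a<..b}) + measure lborel (E \<inter> {b<..c})"
proof -
  have fin: "emeasure lborel (E \<inter> {a<..b}) \<noteq> \<infinity>" for a b
    using emeasure_mono[of "E \<inter> {a<..b}" "{a<..b}" lborel] by (cases "a \<le> b") (auto simp: top_unique)
  have "E \<inter> {a<..c} = (E \<inter> {a<..b}) \<union> (E \<inter> {b<..c})"
    using assms by auto
  moreover have "measure lborel \<dots> = measure lborel (E \<inter> {a<..b}) + measure lborel (E \<inter> {b<..c})"
    by (rule measure_Union) (use assms fin in auto)
  ultimately show ?thesis by simp
qed

lemma periodic_null:
  fixes E :: "real set"
  assumes "\<eta> > 0" and [measurable]: "E \<in> sets borel" and per: "\<And>x. x + \<eta> \<in> E \<longleftrightarrow> x \<in> E"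
    and null: "E \<inter> {0<..\<eta>} \<in> null_sets lborel"
  shows "E \<in> null_sets lborel"
proof -
  have pern: "x + of_nat n * \<eta> \<in> E \<longleftrightarrow> x \<in> E" for x n
  proof (induction n)
    case (Suc n)
    then show ?case using per[of "x + of_nat n * \<eta>"] by (simp add: algebra_simps)
  qed simp
  have peri: "x + of_int k * \<eta> \<in> E \<longleftrightarrow> x \<in> E" for x k
    using pern[of x "nat k"] pern[of "x + of_int k * \<eta>" "nat (-k)"]
    by (cases "k \<ge> 0") (auto simp: algebra_simps)
  have "(\<Union>k::int. {x. 1 * x + of_int k * \<eta> \<in> E \<inter> {0<..\<eta>}}) \<in> null_sets lborel"
    by (intro null_sets_UN null_affine_vimage null) auto
  moreover have "E \<subseteq> (\<Union>k::int. {x. 1 * x + of_int k * \<eta> \<in> E \<inter> {0<..\<eta>}})"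
  proof
    fix x assume x: "x \<in> E"
    define k where "k = 1 - \<lceil>x / \<eta>\<rceil>"
    define j where "j = (of_int \<lceil>x / \<eta>\<rceil> :: real)"
    have "j - 1 < x / \<eta>" "x / \<eta> \<le> j" unfolding j_def by linarith+
    then have "0 < x + of_int k * \<eta>" "x + of_int k * \<eta> \<le> \<eta>"
      using \<open>\<eta> > 0\<close> by (auto simp: k_def field_simps simp flip: j_def)
    then show "x \<in> (\<Union>k::int. {x. 1 * x + of_int k * \<eta> \<in> E \<inter> {0<..\<eta>}})"
      using x peri by auto
  qed
  ultimately show ?thesis
    by (intro null_sets_subset[of _ lborel E]) (use assms(2) in auto)
qed

text \<open>
  Let \<open>D a b\<close> be the excess of the mass of \<open>E\<close> in \<open>(a,b]\<close> over its mean value. Forward invariance makes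
  the excess at least double when the interval is doubled, while periodicity bounds it; so no excess is
  positive. The excesses of \<open>(0,t]\<close> and \<open>(t,\<eta>]\<close> add up to zero, hence both vanish.
\<close>

lemma doubling_invariant_proportional:
  fixes E :: "real set"
  assumes "\<eta> > 0" and E[measurable]: "E \<in> sets borel" and per: "\<And>x. x + \<eta> \<in> E \<longleftrightarrow> x \<in> E"
    and dbl: "\<And>x. x \<in> E \<Longrightarrow> 2 * x \<in> E"
    and t: "0 \<le> t" "t \<le> \<eta>"
  shows "measure lborel (E \<inter> {0<..t}) = measure lborel (E \<inter> {0<..\<eta>}) / \<eta> * t"
proof -
  define m where "m a b = measure lborel (E \<inter> {a<..b})" for a b
  define c where "c = m 0 \<eta> / \<eta>"
  have c0: "c \<ge> 0" using \<open>\<eta> > 0\<close> by (simp add: c_def m_def)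
  have split: "m a d = m a b + m b d" if "a \<le> b" "b \<le> d" for a b d
    unfolding m_def using measure_Ioc_split[OF E that] .
  have mono: "m a b \<ge> 0" for a b by (simp add: m_def)
  have shift: "m (a + \<eta>) (b + \<eta>) = m a b" for a b
  proof -
    have "m a b = measure lborel {x. 1 * x + \<eta> \<in> E \<inter> {a+\<eta><..b+\<eta>}}"
      unfolding m_def by (rule arg_cong[where f="measure lborel"]) (use per in auto)
    also have "\<dots> = m (a + \<eta>) (b + \<eta>)"
      unfolding m_def by (subst measure_affine_vimage) auto
    finally show ?thesis by simp
  qed
  have double: "2 * m a b \<le> m (2 * a) (2 * b)" for a b
  proof -
    have "m a b \<le> measure lborel {x. 2 * x + 0 \<in> E \<inter> {2*a<..2*b}}"
      unfolding m_def
    proof (rule measure_mono_fmeasurable)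
      have s: "{x. 2 * x + 0 \<in> E \<inter> {2*a<..2*b}} \<in> sets borel"
        by (intro borel_affine_vimage) auto
      have "emeasure lborel {x. 2 * x + 0 \<in> E \<inter> {2*a<..2*b}} \<le> emeasure lborel {a..b}"
        by (rule emeasure_mono) auto
      also have "\<dots> < \<infinity>" by (cases "a \<le> b") auto
      finally show "{x. 2 * x + 0 \<in> E \<inter> {2*a<..2*b}} \<in> fmeasurable lborel"
        using s by (auto simp: fmeasurable_def)
    qed (use dbl in auto)
    also have "\<dots> = m (2*a) (2*b) / 2"
      unfolding m_def by (subst measure_affine_vimage) auto
    finally show ?thesis by simp
  qed
  have mult: "m 0 (of_nat n * \<eta>) = of_nat n * m 0 \<eta>" for n
  proof (induction n)
    case (Suc n)
    have "m 0 (of_nat (Suc n) * \<eta>) = m 0 (0 + \<eta>) + m (0 + \<eta>) (of_nat n * \<eta> + \<eta>)"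
      using split[of 0 \<eta> "of_nat n * \<eta> + \<eta>"] \<open>\<eta> > 0\<close> by (simp add: algebra_simps)
    also have "m (0 + \<eta>) (of_nat n * \<eta> + \<eta>) = m 0 (of_nat n * \<eta>)" by (rule shift)
    finally show ?case using Suc by (simp add: algebra_simps)
  qed (simp add: m_def)
  have near: "c * b - c * \<eta> \<le> m 0 b \<and> m 0 b \<le> c * b + c * \<eta>" if "b \<ge> 0" for b
  proof -
    define n where "n = nat \<lfloor>b / \<eta>\<rfloor>"
    have "of_nat n \<le> b / \<eta>" "b / \<eta> < of_nat n + 1"
      using that \<open>\<eta> > 0\<close> by (auto simp: n_def)
    then have n: "of_nat n * \<eta> \<le> b" "b \<le> of_nat (Suc n) * \<eta>"
      using \<open>\<eta> > 0\<close> by (auto simp: field_simps)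
    have "m 0 (of_nat n * \<eta>) \<le> m 0 b" "m 0 b \<le> m 0 (of_nat (Suc n) * \<eta>)"
      using split[of 0 "of_nat n * \<eta>" b] split[of 0 b "of_nat (Suc n) * \<eta>"] n that mono \<open>\<eta> > 0\<close>
      by auto
    moreover have "m 0 (of_nat k * \<eta>) = c * (of_nat k * \<eta>)" if "k = n \<or> k = Suc n" for k
      using mult[of k] \<open>\<eta> > 0\<close> by (simp add: c_def)
    from this[of n] this[of "Suc n"]
    have "m 0 (of_nat n * \<eta>) = c * (of_nat n * \<eta>)"
      "m 0 (of_nat (Suc n) * \<eta>) = c * (of_nat (Suc n) * \<eta>)" by blast+
    moreover have "c * (of_nat (Suc n) * \<eta>) = c * (of_nat n * \<eta>) + c * \<eta>"
      by (simp add: algebra_simps)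
    moreover have "c * (of_nat n * \<eta>) \<le> c * b" "c * b \<le> c * (of_nat (Suc n) * \<eta>)"
      using n c0 by (auto intro: mult_left_mono)
    ultimately show ?thesis by linarith
  qed
  have le: "m a b \<le> c * (b - a)" if ab: "0 \<le> a" "a \<le> b" for a b
  proof -
    have pow: "2 ^ n * m a b \<le> m (2^n * a) (2^n * b)" for n
    proof (induction n)
      case (Suc n)
      then show ?case using double[of "2^n * a" "2^n * b"] by (simp add: mult.assoc)
    qed simp
    have "2 ^ n * (m a b - c * (b - a)) \<le> 2 * c * \<eta>" for n :: nat
    proof -
      have "m (2^n * a) (2^n * b) = m 0 (2^n * b) - m 0 (2^n * a)"
        using split[of 0 "2^n * a" "2^n * b"] ab by auto
      also have "\<dots> \<le> c * (2^n * b) - c * (2^n * a) + 2 * c * \<eta>"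
        using near[of "2^n * a"] near[of "2^n * b"] ab by auto
      finally show ?thesis using pow[of n] by (simp add: algebra_simps)
    qed
    note bd = this
    show ?thesis
    proof (rule ccontr)
      assume "\<not> ?thesis"
      then have pos: "m a b - c * (b - a) > 0" by simp
      \<comment> \<open>A positive excess would outgrow its bound after enough doublings.\<close>
      obtain n where "2 * c * \<eta> / (m a b - c * (b - a)) < 2 ^ n"
        using real_arch_pow[of 2] by auto
      then show False using bd[of n] pos by (simp add: field_simps)
    qed
  qed
  have "m 0 t + m t \<eta> = c * \<eta>" using split[of 0 t \<eta>] t \<open>\<eta> > 0\<close> by (simp add: c_def)
  then have "m 0 t = c * t"
    using le[of 0 t] le[of t \<eta>] t by (simp add: algebra_simps)
  then show ?thesis by (simp add: c_def m_def)
qed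

text \<open>
  By proportionality \<open>E\<close> is independent of every interval in \<open>(0,\<eta>]\<close>, hence of every Borel set, hence of
  its own complement.
\<close>

lemma doubling_invariant_trivial:
  fixes E :: "real set"
  assumes "\<eta> > 0" and E[measurable]: "E \<in> sets borel" and per: "\<And>x. x + \<eta> \<in> E \<longleftrightarrow> x \<in> E"
    and dbl: "\<And>x. x \<in> E \<Longrightarrow> 2 * x \<in> E"
  shows "E \<in> null_sets lborel \<or> - E \<in> null_sets lborel"
proof -
  define c where "c = measure lborel (E \<inter> {0<..\<eta>}) / \<eta>"
  have c0: "c \<ge> 0" using \<open>\<eta> > 0\<close> by (simp add: c_def)
  have fin: "emeasure lborel (E \<inter> {a<..b}) \<noteq> \<infinity>" for a b
    using emeasure_mono[of "E \<inter> {a<..b}" "{a<..b}" lborel] by (cases "a \<le> b") (auto simp: top_unique)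
  define M where "M = density lborel (indicator (E \<inter> {0<..\<eta>}))"
  define N where "N = density lborel (\<lambda>x. ennreal c * indicator {0<..\<eta>} x)"
  have Me: "emeasure M B = emeasure lborel (E \<inter> {0<..\<eta>} \<inter> B)" if "B \<in> sets borel" for B
    using that by (simp add: M_def emeasure_density flip: indicator_inter_arith)
  have Ne: "emeasure N B = ennreal c * emeasure lborel ({0<..\<eta>} \<inter> B)" if "B \<in> sets borel" for B
    using that by (simp add: N_def emeasure_density nn_integral_cmult mult.assoc flip: indicator_inter_arith)
  have "M = N"
  proof (rule measure_eqI_lessThan)
    fix x :: real
    define y where "y = min \<eta> (max 0 x)"
    have y: "0 \<le> y" "y \<le> \<eta>" using \<open>\<eta> > 0\<close> by (auto simp: y_def)
    have eq: "{0<..\<eta>} \<inter> {x<..} = {y<..\<eta>}" by (auto simp: y_def)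
    have "measure lborel (E \<inter> {y<..\<eta>}) = c * (\<eta> - y)"
      using measure_Ioc_split[OF E y] doubling_invariant_proportional[OF assms y]
        \<open>\<eta> > 0\<close>
      by (simp add: c_def field_simps)
    then have "emeasure lborel (E \<inter> {y<..\<eta>}) = ennreal (c * (\<eta> - y))"
      using fin[of y \<eta>] by (simp add: emeasure_eq_ennreal_measure)
    then show "emeasure M {x<..} = emeasure N {x<..}"
      using y c0 by (simp add: Me Ne eq Int_assoc ennreal_mult)
    have "emeasure M {x<..} \<le> emeasure lborel (E \<inter> {0<..\<eta>})"
      by (subst Me) (auto intro: emeasure_mono)
    then show "emeasure M {x<..} < \<infinity>" using fin[of 0 \<eta>]
      by (metis infinity_ennreal_def less_top order_le_less_trans)
  qed (auto simp: M_def N_def)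
  then have "emeasure M (- E) = emeasure N (- E)" by simp
  then have "ennreal c * emeasure lborel ({0<..\<eta>} \<inter> - E) = 0"
    by (simp add: Me Ne Int_assoc)
  then consider "c = 0" | "emeasure lborel ({0<..\<eta>} \<inter> - E) = 0"
    using c0 by auto
  then show ?thesis
  proof cases
    case 1
    then have "emeasure lborel (E \<inter> {0<..\<eta>}) = 0"
      using fin[of 0 \<eta>] \<open>\<eta> > 0\<close> by (simp add: c_def emeasure_eq_ennreal_measure)
    then have "E \<inter> {0<..\<eta>} \<in> null_sets lborel" by (simp add: null_sets_def)
    from periodic_null[OF \<open>\<eta> > 0\<close> E per this] show ?thesis ..
  next
    case 2
    then have "- E \<inter> {0<..\<eta>} \<in> null_sets lborel"
      by (subst Int_commute) (simp add: null_sets_def)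
    moreover have "x + \<eta> \<in> - E \<longleftrightarrow> x \<in> - E" for x using per[of x] by blast
    moreover have "- E \<in> sets borel" using E by auto
    ultimately have "- E \<in> null_sets lborel"
      using \<open>\<eta> > 0\<close> by (metis periodic_null)
    then show ?thesis ..
  qed
qed

section \<open>Birkhoff's ergodic theorem for bounded functions\<close>

text \<open>
  The maximum of the first Birkhoff sums of \<open>f\<close> at \<open>x\<close>, the empty sum included. The recursion along
  \<open>T x\<close> is the cocycle relation that the ergodic theorem exploits.
\<close>

primrec peak :: "('a \<Rightarrow> 'a) \<Rightarrow> ('a \<Rightarrow> real) \<Rightarrow> nat \<Rightarrow> 'a \<Rightarrow> real" where
  "peak T f 0 x = 0"
| "peak T f (Suc n) x = max 0 (f x + peak T f n (T x))"

lemma peak_nonneg: "0 \<le> peak T f n x"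
  by (induction n arbitrary: x) auto

lemma peak_le_Suc: "peak T f n x \<le> peak T f (Suc n) x"
proof (induction n arbitrary: x)
  case (Suc n)
  from Suc[of "T x"] show ?case by (auto simp del: peak.simps(2)[of _ _ "Suc n"] simp: peak.simps(2)[of T f "Suc n" x])
qed simp

lemma peak_mono: "m \<le> n \<Longrightarrow> peak T f m x \<le> peak T f n x"
  by (rule lift_Suc_mono_le[where f="\<lambda>n. peak T f n x", OF peak_le_Suc])

lemma sum_orbit_le_peak: "(\<Sum>k<n. f ((T ^^ k) x)) \<le> peak T f n x"
proof (induction n arbitrary: x)
  case (Suc n)
  have "(\<Sum>k<Suc n. f ((T ^^ k) x)) = f x + (\<Sum>k<n. f ((T ^^ k) (T x)))"
    by (simp add: sum.lessThan_Suc_shift funpow_Suc_right del: sum.lessThan_Suc funpow.simps)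
  then show ?case using Suc[of "T x"] by simp
qed simp

lemma measurable_peak[measurable]:
  assumes [measurable]: "T \<in> measurable M M" "f \<in> borel_measurable M"
  shows "peak T f n \<in> borel_measurable M"
proof (induction n)
  case (Suc n)
  note Suc[measurable]
  have "peak T f (Suc n) = (\<lambda>x. max 0 (f x + peak T f n (T x)))" by auto
  then show ?case by simp
qed simp

locale measure_preserving_map = prob_space M for M :: "'a measure" +
  fixes T :: "'a \<Rightarrow> 'a"
  assumes T[measurable]: "T \<in> measurable M M"
    and invariant: "distr M M T = M"
begin

lemma integral_comp:
  fixes f :: "'a \<Rightarrow> real"
  assumes [measurable]: "f \<in> borel_measurable M"
  shows "(\<integral>x. f (T x) \<partial>M) = (\<integral>x. f x \<partial>M)"
  using integral_distr[OF T, of f] by (simp add: invariant)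

lemma integral_orbit_average:
  fixes f :: "'a \<Rightarrow> real"
  assumes f[measurable]: "f \<in> borel_measurable M" and K: "\<And>x. x \<in> space M \<Longrightarrow> \<bar>f x\<bar> \<le> K"
  shows "(\<integral>x. (\<Sum>k<Suc n. f ((T ^^ k) x)) / Suc n \<partial>M) = (\<integral>x. f x \<partial>M)"
proof -
  have m[measurable]: "T ^^ k \<in> measurable M M" for k
    by (induction k) auto
  have int: "integrable M (\<lambda>x. f ((T ^^ k) x))" for k
    by (rule integrable_const_bound[where B=K]) (use K measurable_space[OF m] in auto)
  have eq: "(\<integral>x. f ((T ^^ k) x) \<partial>M) = (\<integral>x. f x \<partial>M)" for k
  proof (induction k)
    case (Suc k)
    have "(\<integral>x. f ((T ^^ Suc k) x) \<partial>M) = (\<integral>x. (\<lambda>y. f ((T ^^ k) y)) (T x) \<partial>M)"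
      by (simp add: funpow_Suc_right del: funpow.simps)
    also have "\<dots> = (\<integral>x. f ((T ^^ k) x) \<partial>M)" by (rule integral_comp) measurable
    finally show ?case using Suc by simp
  qed simp
  have "(\<integral>x. (\<Sum>k<Suc n. f ((T ^^ k) x)) \<partial>M) = (\<Sum>k<Suc n. \<integral>x. f ((T ^^ k) x) \<partial>M)"
    by (rule Bochner_Integration.integral_sum) (use int in auto)
  also have "\<dots> = Suc n * (\<integral>x. f x \<partial>M)" unfolding eq by simp
  finally show ?thesis by (simp del: sum.lessThan_Suc of_nat_Suc)
qed

end

locale ergodic_map = measure_preserving_map +
  assumes ergodic: "\<And>A. A \<in> sets M \<Longrightarrow> T -` A \<inter> space M = A \<Longrightarrow> emeasure M A = 0 \<or> emeasure M A = 1"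
begin

text \<open>
  The key to the ergodic theorem. The set \<open>A\<close> where the peaks are unbounded is invariant. On \<open>A\<close> the
  difference \<open>peak T f (Suc n) x - peak T f n (T x)\<close> is eventually \<open>f x\<close>, and its integral over \<open>A\<close> is
  nonnegative, because the peaks increase with \<open>n\<close> and \<open>T\<close> preserves both \<open>A\<close> and the measure. So the
  integral of \<open>f\<close> over \<open>A\<close> is nonnegative, which excludes that \<open>A\<close> has full measure.
\<close>

lemma orbit_sums_bounded_above:
  fixes f :: "'a \<Rightarrow> real"
  assumes f[measurable]: "f \<in> borel_measurable M" and K: "\<And>x. x \<in> space M \<Longrightarrow> \<bar>f x\<bar> \<le> K"
    and neg: "(\<integral>x. f x \<partial>M) < 0"
  shows "AE x in M. \<exists>B. \<forall>n. (\<Sum>k<n. f ((T ^^ k) x)) \<le> B"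
proof -
  have K0: "K \<ge> 0" using K not_empty by (metis abs_ge_zero order_trans ex_in_conv)
  have TM: "T x \<in> space M" if "x \<in> space M" for x using that T by (rule measurable_space[rotated])
  let ?p = "peak T f"
  define A where "A = {x \<in> space M. \<forall>b::nat. \<exists>n. ?p n x > real b}"
  have A[measurable]: "A \<in> sets M" unfolding A_def by measurable
  have A_iff: "x \<in> A \<longleftrightarrow> x \<in> space M \<and> (\<forall>b. \<exists>n. ?p n x > b)" for x
    unfolding A_def by (auto, meson order_le_less_trans real_nat_ceiling_ge)
  have A_T: "T x \<in> A \<longleftrightarrow> x \<in> A" if x: "x \<in> space M" for x
  proof
    assume *: "T x \<in> A"
    have "\<exists>n. ?p n x > b" for b
    proof -
      obtain n where "?p n (T x) > b + K" using * A_iff by blast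
      then have "?p (Suc n) x > b" using K[OF x] by auto
      then show ?thesis by blast
    qed
    then show "x \<in> A" using x A_iff by blast
  next
    assume *: "x \<in> A"
    have "\<exists>n. ?p n (T x) > b" for b
    proof -
      obtain n where n: "?p n x > max 0 (b + K)" using * A_iff by blast
      then obtain m where "n = Suc m" by (cases n) auto
      then have "?p m (T x) > b" using n K[OF x] by auto
      then show ?thesis by blast
    qed
    then show "T x \<in> A" using TM[OF x] A_iff by blast
  qed
  have ind_T: "indicator A (T x) = (indicator A x :: real)" if "x \<in> space M" for x
    using A_T[OF that] by (auto simp: indicator_def)
  have pb: "\<bar>?p n x\<bar> \<le> real n * K" if "x \<in> space M" for n x
    using that
  proof (induction n arbitrary: x)
    case (Suc n)
    have "f x + ?p n (T x) \<le> K + real n * K" "0 \<le> K + real n * K"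
      using K[OF Suc.prems] Suc.IH[OF TM[OF Suc.prems]] K0 by auto
    then have "\<bar>?p (Suc n) x\<bar> \<le> K + real n * K" by simp
    then show ?case by (simp only: of_nat_Suc distrib_right mult_1_left add.commute)
  qed simp
  have int_bdd: "integrable M g" if "g \<in> borel_measurable M" "\<And>x. x \<in> space M \<Longrightarrow> \<bar>g x\<bar> \<le> C" for g :: "'a \<Rightarrow> real" and C
    by (rule integrable_const_bound[where B=C]) (use that in auto)
  \<comment> \<open>On A the gain is the increment of the peaks; the maximum form shows that it is bounded by K.\<close>
  define gain where "gain n x = indicator A x * max (- ?p n (T x)) (f x)" for n x
  have gain_eq: "gain n x = indicator A x * ?p (Suc n) x - indicator A (T x) * ?p n (T x)"
    if "x \<in> space M" for n x
    using ind_T[OF that] by (auto simp: gain_def indicator_def max_def)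
  have gain_ge: "0 \<le> (\<integral>x. gain n x \<partial>M)" for n
  proof -
    have i1: "integrable M (\<lambda>x. indicator A x * ?p k x)" for k
      by (rule int_bdd[of _ "real k * K"]) (use pb K0 in \<open>auto simp: indicator_def\<close>)
    have i2: "integrable M (\<lambda>x. indicator A (T x) * ?p k (T x))" for k
      by (rule int_bdd[of _ "real k * K"]) (use pb TM K0 in \<open>auto simp: indicator_def\<close>)
    have "(\<integral>x. gain n x \<partial>M) = (\<integral>x. indicator A x * ?p (Suc n) x - indicator A (T x) * ?p n (T x) \<partial>M)"
      by (rule Bochner_Integration.integral_cong) (use gain_eq in auto)
    also have "\<dots> = (\<integral>x. indicator A x * ?p (Suc n) x \<partial>M) - (\<integral>x. indicator A (T x) * ?p n (T x) \<partial>M)"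
      by (rule Bochner_Integration.integral_diff[OF i1 i2])
    also have "(\<integral>x. indicator A (T x) * ?p n (T x) \<partial>M) = (\<integral>x. indicator A x * ?p n x \<partial>M)"
      by (rule integral_comp) measurable
    also have "(\<integral>x. indicator A x * ?p (Suc n) x \<partial>M) - \<dots> \<ge> 0"
      using integral_mono[OF i1 i1, of n "Suc n"] peak_le_Suc[of T f n]
      by (auto intro!: mult_left_mono simp del: peak.simps)
    finally show ?thesis .
  qed
  have "(\<lambda>n. \<integral>x. gain n x \<partial>M) \<longlonglongrightarrow> (\<integral>x. indicator A x * f x \<partial>M)"
  proof (rule integral_dominated_convergence[where w="\<lambda>_. K"])
    show "AE x in M. (\<lambda>n. gain n x) \<longlonglongrightarrow> indicator A x * f x"
    proof (rule AE_I2)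
      fix x assume x: "x \<in> space M"
      show "(\<lambda>n. gain n x) \<longlonglongrightarrow> indicator A x * f x"
      proof (cases "x \<in> A")
        case True
        then obtain m where m: "?p m (T x) > - f x" using A_iff A_T[OF x] by blast
        have "gain n x = indicator A x * f x" if "n \<ge> m" for n
          using m peak_mono[OF that, of T f "T x"] by (auto simp: gain_def max_def)
        then show ?thesis by (intro tendsto_eventually) (auto simp: eventually_sequentially)
      qed (simp add: gain_def)
    qed
    show "AE x in M. norm (gain n x) \<le> K" for n
    proof (rule AE_I2)
      fix x assume "x \<in> space M"
      from K[OF this] have "\<bar>max (- ?p n (T x)) (f x)\<bar> \<le> K"
        using K0 peak_nonneg[of T f n "T x"] by linarith
      then show "norm (gain n x) \<le> K"
        using K0 by (simp add: gain_def indicator_def)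
    qed
  qed (auto simp: gain_def)
  then have nonneg: "0 \<le> (\<integral>x. indicator A x * f x \<partial>M)"
    by (rule LIMSEQ_le_const) (use gain_ge in auto)
  have "T -` A \<inter> space M = A" using A_T A_iff by auto
  then consider "emeasure M A = 0" | "emeasure M A = 1" using ergodic[OF A] by blast
  then have "A \<in> null_sets M"
  proof cases
    case 2
    then have "AE x in M. x \<in> A" by (intro AE_prob_1) (simp add: measure_def)
    then have "(\<integral>x. indicator A x * f x \<partial>M) = (\<integral>x. f x \<partial>M)"
      by (intro integral_cong_AE) auto
    then show ?thesis using nonneg neg by simp
  qed (use A in auto)
  then show ?thesis
  proof (rule AE_I')
    show "{x \<in> space M. \<not> (\<exists>B. \<forall>n. (\<Sum>k<n. f ((T ^^ k) x)) \<le> B)} \<subseteq> A"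
    proof
      fix x assume x: "x \<in> {x \<in> space M. \<not> (\<exists>B. \<forall>n. (\<Sum>k<n. f ((T ^^ k) x)) \<le> B)}"
      have "\<exists>n. ?p n x > b" for b
      proof -
        obtain n where "(\<Sum>k<n. f ((T ^^ k) x)) > b" using x by (auto simp: not_le)
        then show ?thesis using sum_orbit_le_peak[of f T x n] by (meson order_less_le_trans)
      qed
      then show "x \<in> A" using x A_iff by blast
    qed
  qed
qed

text \<open>
  Subtracting slightly more than the mean from \<open>f\<close> makes the integral negative, and bounded sums of the
  shifted function bound the averages of \<open>f\<close> by the shift in the limit.
\<close>

lemma orbit_averages_eventually_less:
  fixes f :: "'a \<Rightarrow> real"
  assumes f[measurable]: "f \<in> borel_measurable M" and K: "\<And>x. x \<in> space M \<Longrightarrow> \<bar>f x\<bar> \<le> K"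
    and e: "e > 0"
  shows "AE x in M. eventually (\<lambda>n. (\<Sum>k<n. f ((T ^^ k) x)) / n < (\<integral>x. f x \<partial>M) + e) sequentially"
proof -
  let ?I = "\<integral>x. f x \<partial>M"
  have int: "integrable M f"
    by (rule integrable_const_bound[where B=K]) (use K in auto)
  have "AE x in M. \<exists>B. \<forall>n. (\<Sum>k<n. (\<lambda>y. f y - (?I + e / 2)) ((T ^^ k) x)) \<le> B"
  proof (rule orbit_sums_bounded_above)
    show "\<bar>f x - (?I + e / 2)\<bar> \<le> K + \<bar>?I + e / 2\<bar>" if "x \<in> space M" for x
      using K[OF that] by linarith
    show "(\<integral>x. f x - (?I + e / 2) \<partial>M) < 0"
      using int e by (simp add: prob_space)
  qed simp
  then show ?thesis
  proof eventually_elim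
    case (elim x)
    then obtain B where B: "\<And>n. (\<Sum>k<n. f ((T ^^ k) x)) - n * (?I + e / 2) \<le> B"
      by (auto simp: sum_subtractf)
    obtain m :: nat where m: "m > 2 * B / e" using reals_Archimedean2 by blast
    show ?case
      unfolding eventually_sequentially
    proof (intro exI[of _ "Suc m"] allI impI)
      fix n assume n: "Suc m \<le> n"
      then have "2 * B / e < n" using m by linarith
      then have "B < n * (e / 2)" using e by (simp add: field_simps)
      then have "(\<Sum>k<n. f ((T ^^ k) x)) < n * (?I + e)"
        using B[of n] by (simp add: algebra_simps)
      then show "(\<Sum>k<n. f ((T ^^ k) x)) / n < ?I + e"
        using n by (simp add: field_simps)
    qed
  qed
qed

text \<open>
  Birkhoff's ergodic theorem for bounded functions and ergodic maps.
\<close>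

theorem orbit_averages_converge:
  fixes f :: "'a \<Rightarrow> real"
  assumes f[measurable]: "f \<in> borel_measurable M" and K: "\<And>x. x \<in> space M \<Longrightarrow> \<bar>f x\<bar> \<le> K"
  shows "AE x in M. (\<lambda>n. (\<Sum>k<n. f ((T ^^ k) x)) / n) \<longlonglongrightarrow> (\<integral>x. f x \<partial>M)"
proof -
  let ?a = "\<lambda>f x n. (\<Sum>k<n. f ((T ^^ k) x)) / real n" and ?I = "\<integral>x. f x \<partial>M"
  have "AE x in M. \<forall>j. (\<forall>\<^sub>F n in sequentially. ?a f x n < ?I + 1 / Suc j) \<and>
      (\<forall>\<^sub>F n in sequentially. ?a (\<lambda>x. - f x) x n < - ?I + 1 / Suc j)"
    unfolding AE_all_countable
  proof
    fix j
    have "AE x in M. \<forall>\<^sub>F n in sequentially. ?a (\<lambda>x. - f x) x n < (\<integral>x. - f x \<partial>M) + 1 / Suc j"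
      by (rule orbit_averages_eventually_less[where K=K]) (use K in auto)
    then show "AE x in M. (\<forall>\<^sub>F n in sequentially. ?a f x n < ?I + 1 / Suc j) \<and>
        (\<forall>\<^sub>F n in sequentially. ?a (\<lambda>x. - f x) x n < - ?I + 1 / Suc j)"
      using orbit_averages_eventually_less[OF f K, of "1 / Suc j"] by (auto simp del: of_nat_Suc)
  qed
  then show ?thesis
  proof eventually_elim
    case (elim x)
    show ?case
    proof (rule tendstoI)
      fix e :: real assume "e > 0"
      then obtain j where j: "1 / Suc j < e"
        using reals_Archimedean[of e] by (auto simp: inverse_eq_divide)
      have "\<forall>\<^sub>F n in sequentially. ?a f x n < ?I + 1 / Suc j"
        "\<forall>\<^sub>F n in sequentially. ?a (\<lambda>x. - f x) x n < - ?I + 1 / Suc j" using elim by blast+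
      then show "\<forall>\<^sub>F n in sequentially. dist (?a f x n) ?I < e"
        by eventually_elim (use j in \<open>auto simp: dist_real_def sum_negf abs_less_iff\<close>)
    qed
  qed
qed

text \<open>
  The averages of an indicator along orbits converge to its \<open>M\<close>-mean almost everywhere for \<open>M\<close>, hence
  for \<open>N\<close>; their \<open>N\<close>-integrals all equal the \<open>N\<close>-mean.
\<close>

lemma absolutely_continuous_invariant_unique:
  assumes N: "measure_preserving_map N T" and sets: "sets N = sets M"
    and ac: "absolutely_continuous M N"
  shows "N = M"
proof -
  interpret N: measure_preserving_map N T by (rule N)
  show ?thesis
  proof (rule measure_eqI[OF sets])
    fix B assume "B \<in> sets N"
    then have B[measurable]: "B \<in> sets M" "B \<in> sets N" using sets by auto
    let ?f = "indicator B :: 'a \<Rightarrow> real"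
    let ?a = "\<lambda>n x. (\<Sum>k<Suc n. ?f ((T ^^ k) x)) / Suc n"
    have bd: "\<bar>?f x\<bar> \<le> 1" for x by (auto simp: indicator_def)
    have "AE x in M. (\<lambda>n. (\<Sum>k<n. ?f ((T ^^ k) x)) / n) \<longlonglongrightarrow> (\<integral>x. ?f x \<partial>M)"
      by (rule orbit_averages_converge[where K=1]) (use bd in auto)
    then have "AE x in M. (\<lambda>n. ?a n x) \<longlonglongrightarrow> (\<integral>x. ?f x \<partial>M)"
      by eventually_elim (rule LIMSEQ_Suc)
    then have lim: "AE x in N. (\<lambda>n. ?a n x) \<longlonglongrightarrow> (\<integral>x. ?f x \<partial>M)"
      by (rule absolutely_continuous_AE[OF sets ac])
    have m[measurable]: "T ^^ k \<in> measurable N N" for k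
      by (induction k) auto
    have "(\<lambda>n. \<integral>x. ?a n x \<partial>N) \<longlonglongrightarrow> (\<integral>x. (\<integral>x. ?f x \<partial>M) \<partial>N)"
    proof (rule integral_dominated_convergence[where w="\<lambda>_. 1", OF _ _ _ lim])
      show "AE x in N. norm (?a n x) \<le> 1" for n
      proof (rule AE_I2)
        fix x
        have "\<bar>\<Sum>k<Suc n. ?f ((T ^^ k) x)\<bar> \<le> (\<Sum>k<Suc n. 1)"
          by (intro order_trans[OF sum_abs] sum_mono bd)
        then show "norm (?a n x) \<le> 1" by (simp del: sum.lessThan_Suc)
      qed
    qed auto
    moreover have "(\<integral>x. ?a n x \<partial>N) = (\<integral>x. ?f x \<partial>N)" for n
      by (rule N.integral_orbit_average[where K=1]) (use bd in auto)
    ultimately have "(\<integral>x. ?f x \<partial>N) = (\<integral>x. ?f x \<partial>M)"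
      by (simp add: LIMSEQ_const_iff N.prob_space)
    then have "measure N B = measure M B" by simp
    then show "emeasure N B = emeasure M B"
      by (simp add: N.emeasure_eq_measure emeasure_eq_measure)
  qed
qed

end

section \<open>Coalescence and ergodicity of the symmetric doubling maps\<close>

lemma S_left: "x < -1/2 \<Longrightarrow> S \<eta> x = 2 * x + \<eta>"
  and S_mid: "\<bar>x\<bar> \<le> 1/2 \<Longrightarrow> S \<eta> x = 2 * x"
  and S_right: "x > 1/2 \<Longrightarrow> S \<eta> x = 2 * x - \<eta>"
  by (auto simp: S_def d1_def)

lemma S_minus: "S \<eta> (- x) = - S \<eta> x"
  by (auto simp: S_def d1_def)

lemma S_range:
  assumes "1 \<le> \<eta>" "\<eta> \<le> 2" "x \<in> {-1..1}"
  shows "S \<eta> x \<in> {-1..1}"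
  using assms by (auto simp: S_def d1_def)

lemma S_funpow_range:
  assumes "1 \<le> \<eta>" "\<eta> \<le> 2" "x \<in> {-1..1}"
  shows "(S \<eta> ^^ n) x \<in> {-1..1}"
  using assms(3) by (induction n) (use S_range[OF assms(1,2)] in auto)

lemma borel_measurable_S[measurable]: "S \<eta> \<in> borel_measurable borel"
proof -
  have "S \<eta> = (\<lambda>x. 2 * x - (if x < - 1/2 then - \<eta> else if x \<le> 1/2 then 0 else \<eta>))"
    by (auto simp: S_def d1_def)
  then show ?thesis by simp
qed

definition mod_saturation :: "real \<Rightarrow> real set \<Rightarrow> real set" where
  "mod_saturation \<eta> A = {z. \<exists>k::int. z + of_int k * \<eta> \<in> A}"

lemma mod_saturation_borel:
  assumes "A \<in> sets borel"
  shows "mod_saturation \<eta> A \<in> sets borel"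
proof -
  have "mod_saturation \<eta> A = (\<Union>k::int. {z. 1 * z + of_int k * \<eta> \<in> A})"
    by (auto simp: mod_saturation_def)
  also have "\<dots> \<in> sets borel"
    using borel_affine_vimage[OF assms, of 1] by (intro sets.countable_UN') auto
  finally show ?thesis .
qed

lemma mod_saturation_periodic: "x + \<eta> \<in> mod_saturation \<eta> A \<longleftrightarrow> x \<in> mod_saturation \<eta> A"
proof
  assume "x + \<eta> \<in> mod_saturation \<eta> A"
  then obtain k where "x + \<eta> + of_int k * \<eta> \<in> A" by (auto simp: mod_saturation_def)
  then have "x + of_int (k + 1) * \<eta> \<in> A" by (simp add: algebra_simps)
  then show "x \<in> mod_saturation \<eta> A" unfolding mod_saturation_def by blast
next
  assume "x \<in> mod_saturation \<eta> A"
  then obtain k where "x + of_int k * \<eta> \<in> A" by (auto simp: mod_saturation_def)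
  then have "x + \<eta> + of_int (k - 1) * \<eta> \<in> A" by (simp add: algebra_simps)
  then show "x + \<eta> \<in> mod_saturation \<eta> A" unfolding mod_saturation_def by blast
qed

lemma subset_mod_saturation: "A \<subseteq> mod_saturation \<eta> A"
  unfolding mod_saturation_def by (auto intro: exI[of _ 0])

text \<open>
  Modulo \<open>\<eta>\<close> the map \<open>S \<eta>\<close> is doubling, so saturations of forward invariant sets are forward invariant
  under doubling. Invariance of the set in both directions would not pass to the saturation, which is why
  only the forward direction is used.
\<close>

lemma mod_saturation_trivial:
  assumes "\<eta> > 0" "A \<in> sets borel" and A: "\<And>x. x \<in> A \<Longrightarrow> S \<eta> x \<in> A"
  shows "mod_saturation \<eta> A \<in> null_sets lborel \<or> - mod_saturation \<eta> A \<in> null_sets lborel"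
proof (rule doubling_invariant_trivial[OF assms(1)])
  show "mod_saturation \<eta> A \<in> sets borel" by (rule mod_saturation_borel[OF assms(2)])
  show "x + \<eta> \<in> mod_saturation \<eta> A \<longleftrightarrow> x \<in> mod_saturation \<eta> A" for x
    by (rule mod_saturation_periodic)
  show "2 * x \<in> mod_saturation \<eta> A" if "x \<in> mod_saturation \<eta> A" for x
  proof -
    from that obtain k where "x + of_int k * \<eta> \<in> A" by (auto simp: mod_saturation_def)
    from A[OF this] have "2 * x + of_int (2 * k - d1 (x + of_int k * \<eta>)) * \<eta> \<in> A"
      by (simp add: S_def algebra_simps)
    then show ?thesis unfolding mod_saturation_def by blast
  qed
qed

text \<open>
  Two conull saturations would meet in a conull set.
\<close>

lemma forward_invariant_dichotomy:
  assumes "\<eta> > 0" and [measurable]: "A1 \<in> sets borel" "A2 \<in> sets borel"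
    and "\<And>x. x \<in> A1 \<Longrightarrow> S \<eta> x \<in> A1" "\<And>x. x \<in> A2 \<Longrightarrow> S \<eta> x \<in> A2"
    and N: "N \<in> null_sets lborel" "mod_saturation \<eta> A1 \<inter> mod_saturation \<eta> A2 \<subseteq> N"
  shows "A1 \<in> null_sets lborel \<or> A2 \<in> null_sets lborel"
proof -
  have "A \<in> null_sets lborel" if "mod_saturation \<eta> A \<in> null_sets lborel" "A \<in> sets borel" for A
    using null_sets_subset[OF that(1) _ subset_mod_saturation] that(2) by simp
  moreover have False
    if "- mod_saturation \<eta> A1 \<in> null_sets lborel" "- mod_saturation \<eta> A2 \<in> null_sets lborel"
  proof -
    have "(- mod_saturation \<eta> A1 \<union> - mod_saturation \<eta> A2) \<union> N \<in> null_sets lborel"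
      using that N(1) by blast
    also have "(- mod_saturation \<eta> A1 \<union> - mod_saturation \<eta> A2) \<union> N = UNIV" using N(2) by blast
    finally show False by (auto simp: null_sets_def)
  qed
  ultimately show ?thesis
    using mod_saturation_trivial[of \<eta> A1] mod_saturation_trivial[of \<eta> A2] assms by blast
qed

text \<open>
  The exceptional circle points: as long as the doubling orbit of \<open>z\<close> misses the interval modulo \<open>\<eta>\<close>, two
  different points of \<open>[-1,1]\<close> over \<open>z\<close> stay apart.
\<close>

definition avoiding :: "real \<Rightarrow> real set" where
  "avoiding \<eta> = {z. \<forall>n. \<forall>k::int. 2 ^ n * z + of_int k * \<eta> \<notin> {1/2<..<\<eta> - 1/2}}"

text \<open>
  The set is periodic and forward invariant under doubling, and it misses an interval.
\<close>

lemma avoiding_null: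
  assumes "\<eta> > 1"
  shows "avoiding \<eta> \<in> null_sets lborel"
proof -
  have m: "avoiding \<eta> \<in> sets borel"
  proof -
    have "avoiding \<eta> = (\<Inter>n. \<Inter>k::int. {z. 2 ^ n * z + of_int k * \<eta> \<in> - {1/2<..<\<eta> - 1/2}})"
      by (auto simp: avoiding_def)
    also have "\<dots> \<in> sets borel"
      by (intro sets.countable_INT'' borel_affine_vimage[where B = "- {1/2<..<\<eta> - 1/2}"]) auto
    finally show ?thesis .
  qed
  have "avoiding \<eta> \<in> null_sets lborel \<or> - avoiding \<eta> \<in> null_sets lborel"
  proof (rule doubling_invariant_trivial[OF _ m])
    show "\<eta> > 0" using assms by simp
    show "2 * x \<in> avoiding \<eta>" if x: "x \<in> avoiding \<eta>" for x
      unfolding avoiding_def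
    proof (intro CollectI allI)
      fix n and k :: int
      have "2 ^ Suc n * x + of_int k * \<eta> \<notin> {1/2<..<\<eta> - 1/2}" using x unfolding avoiding_def by blast
      then show "2 ^ n * (2 * x) + of_int k * \<eta> \<notin> {1/2<..<\<eta> - 1/2}" by (simp add: algebra_simps)
    qed
    show "x + \<eta> \<in> avoiding \<eta> \<longleftrightarrow> x \<in> avoiding \<eta>" for x
    proof
      assume *: "x + \<eta> \<in> avoiding \<eta>"
      show "x \<in> avoiding \<eta>" unfolding avoiding_def
      proof (intro CollectI allI)
        fix n and k :: int
        have "2 ^ n * (x + \<eta>) + of_int (k - 2 ^ n) * \<eta> \<notin> {1/2<..<\<eta> - 1/2}"
          using * unfolding avoiding_def by blast
        then show "2 ^ n * x + of_int k * \<eta> \<notin> {1/2<..<\<eta> - 1/2}" by (simp add: algebra_simps)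
      qed
    next
      assume *: "x \<in> avoiding \<eta>"
      show "x + \<eta> \<in> avoiding \<eta>" unfolding avoiding_def
      proof (intro CollectI allI)
        fix n and k :: int
        have "2 ^ n * x + of_int (k + 2 ^ n) * \<eta> \<notin> {1/2<..<\<eta> - 1/2}"
          using * unfolding avoiding_def by blast
        then show "2 ^ n * (x + \<eta>) + of_int k * \<eta> \<notin> {1/2<..<\<eta> - 1/2}" by (simp add: algebra_simps)
      qed
    qed
  qed
  moreover have "- avoiding \<eta> \<notin> null_sets lborel"
  proof
    assume *: "- avoiding \<eta> \<in> null_sets lborel"
    have "{1/2<..<\<eta> - 1/2} \<subseteq> - avoiding \<eta>"
    proof
      fix x assume "x \<in> {1/2<..<\<eta> - 1/2}"
      then have "2 ^ 0 * x + of_int 0 * \<eta> \<in> {1/2<..<\<eta> - 1/2}" by simp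
      then show "x \<in> - avoiding \<eta>" unfolding avoiding_def by blast
    qed
    then have "{1/2<..<\<eta> - 1/2} \<in> null_sets lborel"
      using null_sets_subset[OF *] by auto
    then show False using assms by (auto simp: null_sets_def)
  qed
  ultimately show ?thesis by blast
qed

lemma funpow_S_mod: "\<exists>k::int. (S \<eta> ^^ n) x = 2 ^ n * x + of_int k * \<eta>"
proof (induction n)
  case (Suc n)
  then obtain k where "(S \<eta> ^^ n) x = 2 ^ n * x + of_int k * \<eta>" by blast
  then have "(S \<eta> ^^ Suc n) x = 2 ^ Suc n * x + of_int (2 * k - d1 ((S \<eta> ^^ n) x)) * \<eta>"
    by (simp add: S_def algebra_simps)
  then show ?case by blast
qed (auto intro: exI[of _ 0])

text \<open>
  The digits of \<open>x\<close> and \<open>x - \<eta>\<close> differ by \<open>1\<close>, which preserves the distance \<open>\<eta>\<close>, except that they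
  differ by \<open>2\<close> if \<open>x > 1/2\<close> and \<open>x - \<eta> < -1/2\<close>. For \<open>\<eta> = 1\<close> they can agree, namely at \<open>x = 1/2\<close>.
\<close>

lemma S_pair:
  assumes "1 < \<eta>" "\<eta> \<le> 2" "x \<in> {-1..1}" "x - \<eta> \<in> {-1..1}"
  shows "S \<eta> x - S \<eta> (x - \<eta>) = (if 1/2 < x \<and> x < \<eta> - 1/2 then 0 else \<eta>)"
  using assms by (auto simp: S_def d1_def)

lemma orbits_coalesce:
  assumes \<eta>: "1 < \<eta>" "\<eta> \<le> 2" and xy: "x \<in> {-1..1}" "y \<in> {-1..1}" and diff: "x - y = \<eta>"
    and z: "x \<notin> avoiding \<eta>"
  shows "\<exists>n. (S \<eta> ^^ n) x = (S \<eta> ^^ n) y"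
proof (rule ccontr)
  assume ne: "\<nexists>n. (S \<eta> ^^ n) x = (S \<eta> ^^ n) y"
  have r: "(S \<eta> ^^ n) x \<in> {-1..1}" "(S \<eta> ^^ n) y \<in> {-1..1}" for n
    using S_funpow_range xy \<eta> by auto
  have d: "(S \<eta> ^^ n) x - (S \<eta> ^^ n) y = \<eta>" for n
  proof (induction n)
    case (Suc n)
    have "(S \<eta> ^^ Suc n) x \<noteq> (S \<eta> ^^ Suc n) y" using ne by blast
    moreover have "(S \<eta> ^^ n) y = (S \<eta> ^^ n) x - \<eta>" using Suc by simp
    ultimately show ?case using S_pair[OF \<eta> r(1)[of n]] r(2)[of n] by (auto split: if_splits)
  qed (simp add: diff)
  obtain n k where hit: "2 ^ n * x + of_int k * \<eta> \<in> {1/2<..<\<eta> - 1/2}"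
    using z unfolding avoiding_def by blast
  obtain j where j: "(S \<eta> ^^ n) x = 2 ^ n * x + of_int j * \<eta>" using funpow_S_mod by blast
  \<comment> \<open>The pair sits at w and w - eta in [-1,1], which pins w inside (0,eta), so that the translate hitting the interval must be w itself.\<close>
  define w where "w = (S \<eta> ^^ n) x"
  have w: "0 < w" "w < \<eta>" using r(1)[of n] r(2)[of n] d[of n] \<eta> by (auto simp: w_def)
  define i where "i = k - j"
  have i: "w + of_int i * \<eta> \<in> {1/2<..<\<eta> - 1/2}"
    using hit j by (simp add: w_def i_def algebra_simps)
  have "i = 0"
  proof (rule ccontr)
    assume "i \<noteq> 0"
    then have "of_int i \<ge> (1::real) \<or> of_int i \<le> (-1::real)" by linarith
    then have "of_int i * \<eta> \<ge> \<eta> \<or> of_int i * \<eta> \<le> - \<eta>"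
      using \<eta> mult_right_mono[of 1 "of_int i" \<eta>] mult_right_mono[of "of_int i" "-1" \<eta>] by auto
    then show False using i w unfolding greaterThanLessThan_iff by linarith
  qed
  then have "1/2 < w" "w < \<eta> - 1/2" using i by auto
  moreover have "(S \<eta> ^^ n) y = w - \<eta>" using d[of n] by (simp add: w_def)
  ultimately have "(S \<eta> ^^ Suc n) x = (S \<eta> ^^ Suc n) y"
    using S_pair[OF \<eta> r(1)[of n]] r(2)[of n] by (simp add: w_def)
  then show False using ne by blast
qed

lemma mod_neighbours:
  fixes k l :: int and \<eta> z a b :: real
  assumes "\<eta> > 0" "z + of_int k * \<eta> \<in> {a..b}" "z + of_int l * \<eta> \<in> {a..b}" "b - a < 2 * \<eta>"
  shows "\<bar>k - l\<bar> \<le> 1"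
proof (rule ccontr)
  assume "\<not> ?thesis"
  then have "(2::real) \<le> \<bar>of_int (k - l)\<bar>" by linarith
  then have "2 * \<eta> \<le> \<bar>of_int (k - l)\<bar> * \<eta>" using assms(1) by (intro mult_right_mono) auto
  also have "\<dots> = \<bar>of_int (k - l) * \<eta>\<bar>" using assms(1) by (simp add: abs_mult)
  also have "of_int (k - l) * \<eta> = (z + of_int k * \<eta>) - (z + of_int l * \<eta>)" by (simp add: algebra_simps)
  also have "\<bar>\<dots>\<bar> \<le> b - a" using assms(2,3) by auto
  finally show False using assms(4) by simp
qed

lemma funpow_vimage_invariant:
  assumes "\<And>x. x \<in> X \<Longrightarrow> T x \<in> X" "\<And>x. x \<in> X \<Longrightarrow> T x \<in> A \<longleftrightarrow> x \<in> A" "x \<in> X"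
  shows "(T ^^ n) x \<in> X \<and> ((T ^^ n) x \<in> A \<longleftrightarrow> x \<in> A)"
  by (induction n) (use assms in auto)

text \<open>
  Points of \<open>A\<close> and of its complement over the same circle point are neighbours at distance \<open>\<eta>\<close> that never
  coalesce, so their circle point lies in a null set.
\<close>

lemma S_ergodic:
  assumes \<eta>: "1 < \<eta>" "\<eta> \<le> 2" and A[measurable]: "A \<in> sets borel"
    and sub: "A \<subseteq> {-1..1}" and inv: "\<And>x. x \<in> {-1..1} \<Longrightarrow> S \<eta> x \<in> A \<longleftrightarrow> x \<in> A"
  shows "A \<in> null_sets lborel \<or> {-1..1} - A \<in> null_sets lborel"
proof (rule forward_invariant_dichotomy[of \<eta>])
  show "\<eta> > 0" using \<eta> by simp
  have SR: "\<And>x. x \<in> {-1..1} \<Longrightarrow> S \<eta> x \<in> {-1..1}" using \<eta> by (intro S_range) auto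
  show "S \<eta> x \<in> A" if "x \<in> A" for x using that inv sub by blast
  show "S \<eta> x \<in> {-1..1} - A" if "x \<in> {-1..1} - A" for x using that inv SR by blast
  define N where "N = (\<Union>k::int. {z. 1 * z + of_int k * \<eta> \<in> avoiding \<eta>})"
  show "N \<in> null_sets lborel"
    unfolding N_def using \<eta> by (intro null_sets_UN null_affine_vimage avoiding_null) auto
  have same: "x \<in> A \<longleftrightarrow> y \<in> A"
    if "x \<in> {-1..1}" "y \<in> {-1..1}" "x - y = \<eta>" "x \<notin> avoiding \<eta>" for x y
    using orbits_coalesce[OF \<eta> that] funpow_vimage_invariant[OF SR inv] that(1,2) by metis
  show "mod_saturation \<eta> A \<inter> mod_saturation \<eta> ({-1..1} - A) \<subseteq> N"
  proof
    fix z assume "z \<in> mod_saturation \<eta> A \<inter> mod_saturation \<eta> ({-1..1} - A)"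
    then obtain k l :: int where k: "z + of_int k * \<eta> \<in> A" and l: "z + of_int l * \<eta> \<in> {-1..1} - A"
      unfolding mod_saturation_def by blast
    have "\<bar>k - l\<bar> \<le> 1"
      by (rule mod_neighbours[of \<eta> z k "-1" 1 l]) (use k l sub \<eta> in auto)
    moreover have "k \<noteq> l" using k l by auto
    ultimately have "k = l + 1 \<or> l = k + 1" by linarith
    then show "z \<in> N"
    proof
      assume *: "k = l + 1"
      have "z + of_int k * \<eta> \<in> avoiding \<eta>"
      proof (rule ccontr)
        assume "z + of_int k * \<eta> \<notin> avoiding \<eta>"
        moreover have "(z + of_int k * \<eta>) - (z + of_int l * \<eta>) = \<eta>"
          by (simp add: * algebra_simps)
        ultimately show False
          using same[of "z + of_int k * \<eta>" "z + of_int l * \<eta>"] k l sub by blast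
      qed
      then show ?thesis unfolding N_def by auto
    next
      assume *: "l = k + 1"
      have "z + of_int l * \<eta> \<in> avoiding \<eta>"
      proof (rule ccontr)
        assume "z + of_int l * \<eta> \<notin> avoiding \<eta>"
        moreover have "(z + of_int l * \<eta>) - (z + of_int k * \<eta>) = \<eta>"
          by (simp add: * algebra_simps)
        ultimately show False
          using same[of "z + of_int l * \<eta>" "z + of_int k * \<eta>"] k l sub by blast
      qed
      then show ?thesis unfolding N_def by auto
    qed
  qed
qed (use A in auto)

text \<open>
  On \<open>(0,1]\<close> the map \<open>S 1\<close> is the doubling map modulo \<open>1\<close>, and every residue has one representative.
\<close>

lemma S1_ergodic:
  assumes A[measurable]: "A \<in> sets borel"
    and sub: "A \<subseteq> {0<..1}" and inv: "\<And>x. x \<in> {0<..1} \<Longrightarrow> S 1 x \<in> A \<longleftrightarrow> x \<in> A"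
  shows "A \<in> null_sets lborel \<or> {0<..1} - A \<in> null_sets lborel"
proof (rule forward_invariant_dichotomy[of 1])
  have SR: "\<And>x. x \<in> {0<..1} \<Longrightarrow> S 1 x \<in> {0<..1}" by (auto simp: S_def d1_def)
  show "S 1 x \<in> A" if "x \<in> A" for x using that inv sub by blast
  show "S 1 x \<in> {0<..1} - A" if "x \<in> {0<..1} - A" for x using that inv SR by blast
  show "{} \<in> null_sets (lborel :: real measure)" by simp
  show "mod_saturation 1 A \<inter> mod_saturation 1 ({0<..1} - A) \<subseteq> {}"
  proof
    fix z assume "z \<in> mod_saturation 1 A \<inter> mod_saturation 1 ({0<..1} - A)"
    then obtain k l :: int where k: "z + of_int k \<in> A" and l: "z + of_int l \<in> {0<..1} - A"
      unfolding mod_saturation_def by auto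
    have "0 < z + of_int k" "z + of_int k \<le> 1" "0 < z + of_int l" "z + of_int l \<le> 1"
      using k l sub by auto
    then have "k = l" by linarith
    then show "z \<in> {}" using k l by simp
  qed
qed (use A in auto)

section \<open>Transfer of symmetric intervals and the critical orbits\<close>

text \<open>
  The integral over \<open>B\<close> of \<open>sgn t\<close> times the indicator of \<open>[-\<bar>t\<bar>, \<bar>t\<bar>]\<close>, for \<open>t\<close> in \<open>[-1,1]\<close>. Writing it
  as a difference of distribution functions covers both signs of \<open>t\<close>.
\<close>

definition signed_mass :: "real set \<Rightarrow> real \<Rightarrow> real" where
  "signed_mass B t = measure lborel (B \<inter> {-1<..t}) - measure lborel (B \<inter> {-1<..-t})"

lemma signed_mass_minus: "signed_mass B (- t) = - signed_mass B t"
  by (simp add: signed_mass_def)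

lemma signed_mass_pos:
  assumes "B \<in> sets borel" "0 \<le> t" "t \<le> 1"
  shows "signed_mass B t = measure lborel (B \<inter> {-t<..t})"
  using measure_Ioc_split[OF assms(1), of "-1" "-t" t] assms by (simp add: signed_mass_def)

lemma measure_branch:
  fixes a b s :: real
  assumes C: "C \<in> sets borel" and B: "B \<in> sets borel"
    and eq: "\<And>x. a < x \<Longrightarrow> x < b \<Longrightarrow> x \<in> C \<longleftrightarrow> 2 * x + s \<in> B"
  shows "measure lborel (C \<inter> {a<..b}) = measure lborel (B \<inter> {2 * a + s<..2 * b + s}) / 2"
proof -
  \<comment> \<open>Removing the right end point hides the choice of digit at the discontinuities.\<close>
  have "AE x in lborel. x \<noteq> b" by (rule AE_lborel_singleton)
  then have "AE x in lborel. x \<in> C \<inter> {a<..b} \<longleftrightarrow> x \<in> {x. 2 * x + s \<in> B \<inter> {2 * a + s<..2 * b + s}}"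
  proof eventually_elim
    case (elim x)
    then show ?case using eq[of x] by (cases "a < x \<and> x < b") auto
  qed
  then have "measure lborel (C \<inter> {a<..b}) = measure lborel {x. 2 * x + s \<in> B \<inter> {2 * a + s<..2 * b + s}}"
    by (rule measure_eq_AE) (use B C borel_affine_vimage[of "B \<inter> {2 * a + s<..2 * b + s}" 2 s] in auto)
  also have "\<dots> = measure lborel (B \<inter> {2 * a + s<..2 * b + s}) / 2"
    by (rule measure_affine_vimage) (use B in auto)
  finally show ?thesis .
qed

text \<open>
  The action of the transfer operator on symmetric intervals, in weak form. For \<open>t > 1/2\<close> the middle branch covers
  \<open>[-1,1]\<close>, and the right branch maps \<open>(1/2,t]\<close> onto \<open>(1 - \<eta>, S \<eta> t]\<close>; the left branch contributes the mirror image.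
\<close>

lemma signed_mass_S_vimage_pos:
  assumes \<eta>: "1 \<le> \<eta>" "\<eta> \<le> 2" and t: "0 \<le> t" "t \<le> 1" and B: "B \<in> sets borel"
  shows "signed_mass (S \<eta> -` B) t =
    (signed_mass B (S \<eta> t) + of_int (d1 t) * (signed_mass B 1 + signed_mass B (\<eta> - 1))) / 2"
proof -
  let ?C = "S \<eta> -` B"
  have C: "?C \<in> sets borel" using measurable_sets[OF borel_measurable_S B] by simp
  define m where "m A a b = measure lborel (A \<inter> {a<..b})" for A :: "real set" and a b :: real
  have sm: "signed_mass B t = m B (-1) t - m B (-1) (-t)" for t
    by (simp add: signed_mass_def m_def)
  show ?thesis
  proof (cases "t \<le> 1/2")
    case True
    have "signed_mass ?C t = m ?C (-t) t" using signed_mass_pos[OF C] t by (simp add: m_def)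
    also have "\<dots> = m B (2 * (-t) + 0) (2 * t + 0) / 2" unfolding m_def
      by (rule measure_branch[OF C B]) (use True t in \<open>auto simp: S_mid\<close>)
    also have "\<dots> = signed_mass B (2 * t) / 2"
      using signed_mass_pos[OF B, of "2 * t"] t True by (simp add: m_def)
    finally show ?thesis using True t by (simp add: S_mid d1_def)
  next
    case False
    have "signed_mass ?C t = m ?C (-t) t" using signed_mass_pos[OF C] t by (simp add: m_def)
    also have "\<dots> = m ?C (-t) (-1/2) + m ?C (-1/2) (1/2) + m ?C (1/2) t"
      using measure_Ioc_split[OF C, of "-t" "-1/2" t] measure_Ioc_split[OF C, of "-1/2" "1/2" t] False
      by (simp add: m_def)
    also have "m ?C (-t) (-1/2) = m B (2 * (-t) + \<eta>) (2 * (-1/2) + \<eta>) / 2" unfolding m_def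
      by (rule measure_branch[OF C B]) (auto simp: S_left)
    also have "m ?C (-1/2) (1/2) = m B (2 * (-1/2) + 0) (2 * (1/2) + 0) / 2" unfolding m_def
      by (rule measure_branch[OF C B]) (auto simp: S_mid)
    also have "m ?C (1/2) t = m B (2 * (1/2) + - \<eta>) (2 * t + - \<eta>) / 2" unfolding m_def
      by (rule measure_branch[OF C B]) (auto simp: S_right)
    also have "m B (2 * (-t) + \<eta>) (2 * (-1/2) + \<eta>) = m B (-1) (\<eta> - 1) - m B (-1) (- (2 * t - \<eta>))"
      using measure_Ioc_split[OF B, of "-1" "\<eta> - 2 * t" "\<eta> - 1"] False t \<eta> by (simp add: m_def)
    also have "m B (2 * (1/2) + - \<eta>) (2 * t + - \<eta>) = m B (-1) (2 * t - \<eta>) - m B (-1) (- (\<eta> - 1))"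
      using measure_Ioc_split[OF B, of "-1" "1 - \<eta>" "2 * t - \<eta>"] False t \<eta> by (simp add: m_def)
    also have "m B (2 * (-1/2) + 0) (2 * (1/2) + 0) = m B (-1) 1 - m B (-1) (-1)"
      by (simp add: m_def)
    finally show ?thesis using False by (simp add: S_right d1_def sm) argo
  qed
qed

lemma signed_mass_S_vimage:
  assumes \<eta>: "1 \<le> \<eta>" "\<eta> \<le> 2" and t: "t \<in> {-1..1}" and B: "B \<in> sets borel"
  shows "signed_mass (S \<eta> -` B) t =
    (signed_mass B (S \<eta> t) + of_int (d1 t) * (signed_mass B 1 + signed_mass B (\<eta> - 1))) / 2"
proof (cases "t \<ge> 0")
  case False
  then have "signed_mass (S \<eta> -` B) (- t) =
    (signed_mass B (S \<eta> (- t)) + of_int (d1 (- t)) * (signed_mass B 1 + signed_mass B (\<eta> - 1))) / 2"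
    using signed_mass_S_vimage_pos[OF \<eta> _ _ B, of "- t"] t by auto
  moreover have "d1 (- t) = - d1 t" by (auto simp: d1_def)
  ultimately show ?thesis by (simp add: signed_mass_minus S_minus field_simps)
qed (use signed_mass_S_vimage_pos[OF \<eta> _ _ B, of t] t in auto)

lemma abs_signed_mass_le:
  assumes "B \<in> sets borel" "t \<in> {-1..1}"
  shows "\<bar>signed_mass B t\<bar> \<le> 2"
proof -
  have "measure lborel (B \<inter> {-1<..s}) \<le> 2" if "s \<le> 1" for s
  proof -
    have "measure lborel (B \<inter> {-1<..s}) \<le> measure lborel {-1..1::real}"
      by (rule measure_mono_fmeasurable) (use assms that in \<open>auto simp: fmeasurable_def\<close>)
    then show ?thesis by simp
  qed
  moreover have "measure lborel (B \<inter> {-1<..s}) \<ge> 0" for s by simp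
  ultimately show ?thesis using assms(2) unfolding signed_mass_def abs_le_iff
    by (smt (verit) atLeastAtMost_iff)
qed

lemma signed_mass_interval:
  assumes "0 \<le> r" "r \<le> 1" "t \<in> {-1..1}"
  shows "signed_mass {-r..r} t = 2 * max (- r) (min r t)"
proof -
  have *: "signed_mass {-r..r} s = 2 * min r s" if "0 \<le> s" "s \<le> 1" for s
  proof -
    have "AE x in lborel. x \<in> {-r..r} \<inter> {-s<..s} \<longleftrightarrow> x \<in> {- min r s..min r s}"
      using AE_lborel_singleton[of "-s"] by eventually_elim auto
    then have "measure lborel ({-r..r} \<inter> {-s<..s}) = measure lborel {- min r s..min r s}"
      by (rule measure_eq_AE) auto
    moreover have "- min r s \<le> min r s" using that assms by auto
    ultimately show ?thesis using that assms by (subst signed_mass_pos) (auto simp del: neg_le_iff_le)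
  qed
  show ?thesis
    using *[of t] *[of "-t"] signed_mass_minus[of "{-r..r}" t] assms
    by (cases "t \<ge> 0") auto
qed

abbreviation upper_orbit :: "real \<Rightarrow> nat \<Rightarrow> real" where
  "upper_orbit \<eta> n \<equiv> (S \<eta> ^^ n) 1"

abbreviation lower_orbit :: "real \<Rightarrow> nat \<Rightarrow> real" where
  "lower_orbit \<eta> n \<equiv> (S \<eta> ^^ n) (1 - \<eta>)"

lemma critical_orbits_range:
  assumes "1 \<le> \<eta>" "\<eta> \<le> 2"
  shows "upper_orbit \<eta> n \<in> {-1..1}" "lower_orbit \<eta> n \<in> {-1..1}"
  using S_funpow_range[OF assms] assms by auto

text \<open>
  The one-sided images \<open>1\<close> and \<open>1 - \<eta>\<close> of the discontinuity \<open>1/2\<close> are representatives of one circle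
  point, so their orbits form a pair to which coalescence applies.
\<close>

lemma critical_orbits_gap:
  assumes "1 < \<eta>" "\<eta> \<le> 2"
  shows "lower_orbit \<eta> n = upper_orbit \<eta> n \<or> lower_orbit \<eta> n = upper_orbit \<eta> n - \<eta>"
proof (induction n)
  case (Suc n)
  then show ?case
  proof
    assume *: "lower_orbit \<eta> n = upper_orbit \<eta> n - \<eta>"
    show ?thesis
      using S_pair[OF assms, of "upper_orbit \<eta> n"] critical_orbits_range[of \<eta> n] assms
      unfolding * by (auto simp: * split: if_splits)
  qed simp
qed simp

text \<open>
  The mass that the \<open>n\<close>-th term of the invariant density gives to \<open>B\<close>.
\<close>

definition mass_term :: "real \<Rightarrow> real set \<Rightarrow> nat \<Rightarrow> real" where
  "mass_term \<eta> B n = (1/2) ^ n * (signed_mass B (upper_orbit \<eta> n) - signed_mass B (lower_orbit \<eta> n))"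

lemma summable_mass_term:
  assumes "1 \<le> \<eta>" "\<eta> \<le> 2" "B \<in> sets borel"
  shows "summable (mass_term \<eta> B)"
proof (rule summable_comparison_test')
  show "summable (\<lambda>n. 4 * (1/2) ^ n :: real)" by (intro summable_mult summable_geometric) simp
  fix n :: nat
  have "\<bar>signed_mass B (upper_orbit \<eta> n) - signed_mass B (lower_orbit \<eta> n)\<bar> \<le> 4"
    using abs_signed_mass_le[OF assms(3)] critical_orbits_range[OF assms(1,2), of n]
    by (smt (verit))
  then show "norm (mass_term \<eta> B n) \<le> 4 * (1/2) ^ n"
    by (simp add: mass_term_def abs_mult)
qed

text \<open>
  The signed binary expansions of \<open>1\<close> and \<open>1 - \<eta>\<close>, whose difference is \<open>\<eta>\<close>, cut off after \<open>N\<close> digits.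
\<close>

lemma sum_digit_difference:
  assumes "\<eta> > 0"
  shows "(\<Sum>n<N. (1/2) ^ Suc n * of_int (d1 (upper_orbit \<eta> n) - d1 (lower_orbit \<eta> n))) =
    1 - (1/2) ^ N * ((upper_orbit \<eta> N - lower_orbit \<eta> N) / \<eta>)"
proof (induction N)
  case (Suc N)
  have "upper_orbit \<eta> (Suc N) - lower_orbit \<eta> (Suc N) =
    2 * (upper_orbit \<eta> N - lower_orbit \<eta> N) - of_int (d1 (upper_orbit \<eta> N) - d1 (lower_orbit \<eta> N)) * \<eta>"
    by (simp add: S_def algebra_simps)
  then have gap: "(upper_orbit \<eta> (Suc N) - lower_orbit \<eta> (Suc N)) / \<eta> =
    2 * ((upper_orbit \<eta> N - lower_orbit \<eta> N) / \<eta>) - of_int (d1 (upper_orbit \<eta> N) - d1 (lower_orbit \<eta> N))"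
    using assms by (simp add: field_simps del: funpow.simps)
  show ?case
    unfolding gap sum.lessThan_Suc Suc by (simp add: algebra_simps)
qed (use assms in simp)

text \<open>
  Passing to the preimage shifts the series by one index and adds a multiple of the first term for every
  digit; the weighted digit differences sum to \<open>1\<close>, which restores exactly the term lost by the shift.
\<close>

lemma suminf_mass_term_invariant:
  assumes \<eta>: "1 \<le> \<eta>" "\<eta> \<le> 2" and B: "B \<in> sets borel"
  shows "suminf (mass_term \<eta> (S \<eta> -` B)) = suminf (mass_term \<eta> B)"
proof -
  let ?C = "S \<eta> -` B" and ?u = "upper_orbit \<eta>" and ?v = "lower_orbit \<eta>"
  have C: "?C \<in> sets borel" using measurable_sets[OF borel_measurable_S B] by simp
  define K where "K = signed_mass B 1 + signed_mass B (\<eta> - 1)"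
  have K: "K = mass_term \<eta> B 0"
    using signed_mass_minus[of B "\<eta> - 1"] by (simp add: K_def mass_term_def)
  have step: "mass_term \<eta> ?C n = mass_term \<eta> B (Suc n) + K * ((1/2) ^ Suc n * of_int (d1 (?u n) - d1 (?v n)))" for n
  proof -
    define c where "c = (1/2::real) ^ n"
    show ?thesis
      unfolding mass_term_def signed_mass_S_vimage[OF \<eta> critical_orbits_range(1)[OF \<eta>] B]
        signed_mass_S_vimage[OF \<eta> critical_orbits_range(2)[OF \<eta>] B] K_def power_Suc funpow.simps comp_def
        c_def[symmetric]
      by (simp add: algebra_simps add_divide_distrib diff_divide_distrib)
  qed
  have part: "(\<Sum>n<N. mass_term \<eta> ?C n) = (\<Sum>n<Suc N. mass_term \<eta> B n) - K * ((1/2) ^ N * ((?u N - ?v N) / \<eta>))" for N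
  proof -
    have "(\<Sum>n<N. mass_term \<eta> ?C n) = (\<Sum>n<N. mass_term \<eta> B (Suc n)) + K * (1 - (1/2) ^ N * ((?u N - ?v N) / \<eta>))"
    proof -
      have "\<eta> > 0" using \<eta> by simp
      show ?thesis
        unfolding step sum.distrib sum_distrib_left[symmetric] sum_digit_difference[OF \<open>\<eta> > 0\<close>] ..
    qed
    then show ?thesis by (simp add: sum.lessThan_Suc_shift K algebra_simps del: sum.lessThan_Suc)
  qed
  have "(\<lambda>N. (1/2) ^ N * ((?u N - ?v N) / \<eta>)) \<longlonglongrightarrow> 0"
  proof (rule Lim_null_comparison)
    show "\<forall>\<^sub>F N in sequentially. norm ((1/2) ^ N * ((?u N - ?v N) / \<eta>)) \<le> (1/2) ^ N * 2"
    proof (intro always_eventually allI)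
      fix N
      have "\<bar>?u N - ?v N\<bar> \<le> 2" using critical_orbits_range[OF \<eta>, of N] by auto
      then have "\<bar>(?u N - ?v N) / \<eta>\<bar> \<le> 2" using \<eta> by (simp add: abs_divide divide_le_eq)
      then show "norm ((1/2) ^ N * ((?u N - ?v N) / \<eta>)) \<le> (1/2) ^ N * 2"
        unfolding real_norm_def abs_mult by (intro mult_mono) auto
    qed
    show "(\<lambda>N. (1/2) ^ N * 2 :: real) \<longlonglongrightarrow> 0"
      by (intro tendsto_mult_left_zero LIMSEQ_realpow_zero) auto
  qed
  from tendsto_mult_right_zero[OF this, of K]
  have "(\<lambda>N. (\<Sum>n<Suc N. mass_term \<eta> B n) - K * ((1/2) ^ N * ((?u N - ?v N) / \<eta>))) \<longlonglongrightarrow> suminf (mass_term \<eta> B) - 0"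
    by (intro tendsto_diff LIMSEQ_Suc summable_LIMSEQ summable_mass_term \<eta> B)
  then have "(\<lambda>N. \<Sum>n<N. mass_term \<eta> ?C n) \<longlonglongrightarrow> suminf (mass_term \<eta> B)"
    unfolding part by simp
  moreover have "(\<lambda>N. \<Sum>n<N. mass_term \<eta> ?C n) \<longlonglongrightarrow> suminf (mass_term \<eta> ?C)"
    by (intro summable_LIMSEQ summable_mass_term \<eta> C)
  ultimately show ?thesis by (rule LIMSEQ_unique[rotated])
qed

section \<open>The invariant density\<close>

text \<open>
  The difference of the signed indicators that belong to \<open>u\<close> and \<open>v\<close>, up to end points. As \<open>v\<close> is nonpositive and
  \<open>u\<close> nonnegative unless they coincide, the case distinction makes it a sum of indicators, so that the density is
  a series of nonnegative terms.
\<close>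

definition layer :: "real \<Rightarrow> nat \<Rightarrow> real \<Rightarrow> real" where
  "layer \<eta> n x = (let u = upper_orbit \<eta> n; v = lower_orbit \<eta> n in
     if v = u then 0 else indicator {-u<..u} x + indicator {v<..-v} x)"

definition invariant_density :: "real \<Rightarrow> real \<Rightarrow> ennreal" where
  "invariant_density \<eta> x = (\<Sum>n. ennreal ((1/2) ^ n * layer \<eta> n x))"

lemma borel_measurable_layer[measurable]: "layer \<eta> n \<in> borel_measurable borel"
  unfolding layer_def[abs_def] Let_def by measurable

lemma borel_measurable_invariant_density[measurable]: "invariant_density \<eta> \<in> borel_measurable borel"
  unfolding invariant_density_def[abs_def] by measurable

lemma invariant_density_pos:
  assumes "\<eta> \<noteq> 0" "-1 < x" "x \<le> 1"
  shows "0 < invariant_density \<eta> x"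
proof -
  \<comment> \<open>The term with index 0 alone is at least 1 here.\<close>
  have "0 < ennreal ((1/2) ^ 0 * layer \<eta> 0 x)"
    using assms by (simp add: layer_def Let_def add_pos_nonneg)
  also have "\<dots> \<le> (\<Sum>n<Suc 0. ennreal ((1/2) ^ n * layer \<eta> n x))" by simp
  also have "\<dots> \<le> invariant_density \<eta> x"
    unfolding invariant_density_def by (rule sum_le_suminf) auto
  finally show ?thesis .
qed

lemma nn_integral_layer:
  assumes \<eta>: "1 < \<eta>" "\<eta> \<le> 2" and B[measurable]: "B \<in> sets borel"
  shows "(\<integral>\<^sup>+x. ennreal ((1/2) ^ n * layer \<eta> n x) * indicator B x \<partial>lborel) = ennreal (mass_term \<eta> B n)"
    and "0 \<le> mass_term \<eta> B n"
proof -
  let ?u = "upper_orbit \<eta> n" and ?v = "lower_orbit \<eta> n"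
  have r: "?u \<in> {-1..1}" "?v \<in> {-1..1}" using critical_orbits_range \<eta> by auto
  have "(\<integral>\<^sup>+x. ennreal ((1/2) ^ n * layer \<eta> n x) * indicator B x \<partial>lborel) = ennreal (mass_term \<eta> B n) \<and> 0 \<le> mass_term \<eta> B n"
  proof (cases "?v = ?u")
    case False
    then have v: "?v = ?u - \<eta>" using critical_orbits_gap[OF \<eta>, of n] by blast
    have uv: "0 \<le> ?u" "?v \<le> 0" using v r \<eta> by auto
    have fin: "emeasure lborel (B \<inter> {a<..b}) = ennreal (measure lborel (B \<inter> {a<..b}))" for a b
    proof (rule emeasure_eq_ennreal_measure)
      have "emeasure lborel (B \<inter> {a<..b}) \<le> emeasure lborel {a<..b}" by (intro emeasure_mono) auto
      also have "\<dots> < \<top>" by (cases "a \<le> b") auto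
      finally show "emeasure lborel (B \<inter> {a<..b}) \<noteq> \<top>" by simp
    qed
    have eq: "mass_term \<eta> B n = (1/2) ^ n * (measure lborel (B \<inter> {-?u<..?u}) + measure lborel (B \<inter> {?v<..-?v}))"
      using signed_mass_pos[OF B, of ?u] signed_mass_pos[OF B, of "- ?v"] signed_mass_minus[of B ?v] uv r
      by (simp add: mass_term_def)
    have "(\<integral>\<^sup>+x. ennreal ((1/2) ^ n * layer \<eta> n x) * indicator B x \<partial>lborel) =
      (\<integral>\<^sup>+x. ennreal ((1/2) ^ n) * (indicator (B \<inter> {-?u<..?u}) x + indicator (B \<inter> {?v<..-?v}) x) \<partial>lborel)"
      by (intro nn_integral_cong) (use False in \<open>auto simp: layer_def Let_def indicator_def ennreal_mult' simp flip: ennreal_plus\<close>)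
    also have "\<dots> = ennreal ((1/2) ^ n) * (emeasure lborel (B \<inter> {-?u<..?u}) + emeasure lborel (B \<inter> {?v<..-?v}))"
      by (simp add: nn_integral_cmult nn_integral_add)
    also have "\<dots> = ennreal (mass_term \<eta> B n)"
      unfolding fin eq by (subst ennreal_mult) (auto simp: ennreal_plus)
    finally show ?thesis unfolding eq by simp
  qed (simp add: layer_def mass_term_def)
  then show "(\<integral>\<^sup>+x. ennreal ((1/2) ^ n * layer \<eta> n x) * indicator B x \<partial>lborel) = ennreal (mass_term \<eta> B n)"
    "0 \<le> mass_term \<eta> B n" by auto
qed

lemma nn_integral_invariant_density:
  assumes \<eta>: "1 < \<eta>" "\<eta> \<le> 2" and B[measurable]: "B \<in> sets borel"
  shows "(\<integral>\<^sup>+x. invariant_density \<eta> x * indicator B x \<partial>lborel) = ennreal (suminf (mass_term \<eta> B))"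
proof -
  have "(\<integral>\<^sup>+x. invariant_density \<eta> x * indicator B x \<partial>lborel) =
    (\<integral>\<^sup>+x. (\<Sum>n. ennreal ((1/2) ^ n * layer \<eta> n x) * indicator B x) \<partial>lborel)"
    by (simp add: invariant_density_def ennreal_suminf_multc)
  also have "\<dots> = (\<Sum>n. ennreal (mass_term \<eta> B n))"
    by (subst nn_integral_suminf) (auto simp: nn_integral_layer[OF \<eta> B])
  also have "\<dots> = ennreal (suminf (mass_term \<eta> B))"
    using summable_mass_term[of \<eta> B] \<eta> B nn_integral_layer(2)[OF \<eta> B]
    by (intro suminf_ennreal_eq summable_sums) auto
  finally show ?thesis .
qed

definition acip_measure :: "real \<Rightarrow> real measure" where
  "acip_measure \<eta> = density leb (\<lambda>x. ennreal (1 / suminf (mass_term \<eta> {-1..1})) * invariant_density \<eta> x)"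

lemma space_leb: "space leb = {-1..1}"
  by (simp add: leb_def space_restrict_space)

lemma sets_leb: "B \<in> sets leb \<longleftrightarrow> B \<in> sets borel \<and> B \<subseteq> {-1..1}"
  unfolding leb_def by (subst sets_restrict_space_iff) auto

lemma AE_leb: "(AE x in leb. P x) \<longleftrightarrow> (AE x in lborel. x \<in> {-1..1} \<longrightarrow> P x)"
  unfolding leb_def by (subst AE_restrict_space_iff) auto

lemma null_sets_leb: "B \<in> null_sets leb \<longleftrightarrow> B \<in> null_sets lborel \<and> B \<subseteq> {-1..1}"
  unfolding leb_def by (subst null_sets_restrict_space) auto

lemma acip_measure_total_pos:
  assumes "1 < \<eta>" "\<eta> \<le> 2"
  shows "0 < suminf (mass_term \<eta> {-1..1})"
proof -
  have "0 < mass_term \<eta> {-1..1} 0"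
    using signed_mass_interval[of 1 1] signed_mass_interval[of 1 "1 - \<eta>"] assms
    by (simp add: mass_term_def)
  also have "\<dots> \<le> suminf (mass_term \<eta> {-1..1})"
    using sum_le_suminf[OF summable_mass_term[of \<eta> "{-1..1}"], of "{0}"] assms
      nn_integral_layer(2)[OF assms, of "{-1..1}"] by auto
  finally show ?thesis .
qed

lemma borel_measurable_density_leb[measurable]:
  "(\<lambda>x. c * invariant_density \<eta> x) \<in> borel_measurable leb"
  unfolding leb_def by (intro measurable_restrict_space1) simp

lemma emeasure_acip_measure:
  assumes \<eta>: "1 < \<eta>" "\<eta> \<le> 2" and B: "B \<in> sets borel" "B \<subseteq> {-1..1}"
  shows "emeasure (acip_measure \<eta>) B = ennreal (suminf (mass_term \<eta> B) / suminf (mass_term \<eta> {-1..1}))"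
proof -
  let ?Z = "suminf (mass_term \<eta> {-1..1})"
  note Z = acip_measure_total_pos[OF \<eta>]
  have "emeasure (acip_measure \<eta>) B = (\<integral>\<^sup>+x. ennreal (1 / ?Z) * invariant_density \<eta> x * indicator B x \<partial>leb)"
    unfolding acip_measure_def using B by (intro emeasure_density) (auto simp: sets_leb)
  also have "\<dots> = (\<integral>\<^sup>+x. ennreal (1 / ?Z) * invariant_density \<eta> x * indicator B x * indicator {-1..1} x \<partial>lborel)"
    unfolding leb_def by (rule nn_integral_restrict_space) auto
  also have "\<dots> = (\<integral>\<^sup>+x. ennreal (1 / ?Z) * (invariant_density \<eta> x * indicator B x) \<partial>lborel)"
    by (intro nn_integral_cong) (use B in \<open>auto simp: indicator_def\<close>)
  also have "\<dots> = ennreal (1 / ?Z) * ennreal (suminf (mass_term \<eta> B))"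
    using B by (subst nn_integral_cmult) (auto simp: nn_integral_invariant_density[OF \<eta>])
  also have "\<dots> = ennreal (suminf (mass_term \<eta> B) / ?Z)"
    using Z by (subst ennreal_mult'[symmetric]) auto
  finally show ?thesis .
qed

lemma sets_acip_measure: "sets (acip_measure \<eta>) = sets leb"
  by (simp add: acip_measure_def)

lemma space_acip_measure: "space (acip_measure \<eta>) = {-1..1}"
  by (simp add: acip_measure_def space_leb)

lemma S_measurable_leb:
  assumes "1 \<le> \<eta>" "\<eta> \<le> 2"
  shows "S \<eta> \<in> measurable leb leb"
  unfolding leb_def
  by (intro measurable_restrict_space3) (use S_range[OF assms] in auto)

lemma mass_term_restrict:
  assumes "1 \<le> \<eta>" "\<eta> \<le> 2"
  shows "mass_term \<eta> (B \<inter> {-1..1}) = mass_term \<eta> B"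
proof
  fix n
  have "signed_mass (B \<inter> {-1..1}) t = signed_mass B t" if "t \<in> {-1..1}" for t
  proof -
    have "B \<inter> {-1..1} \<inter> {-1<..s} = B \<inter> {-1<..s}" if "s \<le> 1" for s :: real
      using that by auto
    then show ?thesis using that by (simp add: signed_mass_def)
  qed
  then show "mass_term \<eta> (B \<inter> {-1..1}) n = mass_term \<eta> B n"
    using critical_orbits_range[OF assms, of n] by (simp add: mass_term_def)
qed

text \<open>
  Invariance is that of the mass series. Triviality of invariant sets carries over from Lebesgue measure,
  because its null sets are null for the density measure.
\<close>

lemma acip_measure_ergodic:
  assumes \<eta>: "1 < \<eta>" "\<eta> \<le> 2"
  shows "ergodic_map (acip_measure \<eta>) (S \<eta>)"
proof -
  let ?M = "acip_measure \<eta>"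
  have \<eta>1: "1 \<le> \<eta>" using \<eta> by simp
  have T: "S \<eta> \<in> measurable ?M ?M"
    using S_measurable_leb[OF \<eta>1 \<eta>(2)] by (simp add: sets_acip_measure cong: measurable_cong_sets)
  interpret prob_space ?M
    by (rule prob_spaceI)
      (use emeasure_acip_measure[OF \<eta>, of "{-1..1}"] acip_measure_total_pos[OF \<eta>] in \<open>simp add: space_acip_measure\<close>)
  show ?thesis
  proof unfold_locales
    show "S \<eta> \<in> measurable ?M ?M" by (rule T)
    show "distr ?M ?M (S \<eta>) = ?M"
    proof (rule measure_eqI)
      fix B assume "B \<in> sets (distr ?M ?M (S \<eta>))"
      then have B: "B \<in> sets borel" "B \<subseteq> {-1..1}" "B \<in> sets ?M" by (auto simp: sets_acip_measure sets_leb)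
      have C: "S \<eta> -` B \<in> sets borel" using measurable_sets[OF borel_measurable_S B(1)] by simp
      have "emeasure (distr ?M ?M (S \<eta>)) B = emeasure ?M (S \<eta> -` B \<inter> {-1..1})"
        using emeasure_distr[OF T B(3)] by (simp add: space_acip_measure)
      also have "\<dots> = emeasure ?M B"
        using B C suminf_mass_term_invariant[OF \<eta>1 \<eta>(2) B(1)]
        by (simp add: emeasure_acip_measure[OF \<eta>] mass_term_restrict[OF \<eta>1 \<eta>(2)])
      finally show "emeasure (distr ?M ?M (S \<eta>)) B = emeasure ?M B" .
    qed simp
    fix A assume A: "A \<in> sets ?M" "S \<eta> -` A \<inter> space ?M = A"
    have null: "emeasure ?M N = 0" if "N \<in> null_sets lborel" "N \<subseteq> {-1..1}" for N
    proof -
      have "absolutely_continuous leb ?M"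
        unfolding acip_measure_def by (rule absolutely_continuousI_density) measurable
      then show ?thesis using that by (auto simp: absolutely_continuous_def null_sets_leb)
    qed
    have A': "A \<in> sets borel" "A \<subseteq> {-1..1}" using A(1) by (auto simp: sets_acip_measure sets_leb)
    have "A \<in> null_sets lborel \<or> {-1..1} - A \<in> null_sets lborel"
      by (rule S_ergodic[OF \<eta> A']) (use A(2) in \<open>auto simp: space_acip_measure\<close>)
    then show "emeasure ?M A = 0 \<or> emeasure ?M A = 1"
    proof
      assume "{-1..1} - A \<in> null_sets lborel"
      then have "prob (space ?M - A) = 0"
        using null[of "{-1..1} - A"] by (simp add: space_acip_measure measure_def)
      then show ?thesis using prob_compl[OF A(1)] by (simp add: emeasure_eq_measure)
    qed (use null A' in blast)
  qed
qed

text \<open>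
  The density is positive except at the point \<open>-1\<close>, so the two measures have the same null sets. This is
  what makes statements about typical points statements about Lebesgue measure, and what makes every
  absolutely continuous measure absolutely continuous for the invariant one.
\<close>

lemma AE_acip_measure_iff:
  assumes \<eta>: "1 < \<eta>" "\<eta> \<le> 2"
  shows "(AE x in acip_measure \<eta>. P x) \<longleftrightarrow> (AE x in leb. P x)"
proof -
  have pos: "AE x in leb. 0 < ennreal (1 / suminf (mass_term \<eta> {-1..1})) * invariant_density \<eta> x"
    unfolding AE_leb using AE_lborel_singleton[of "-1::real"]
  proof eventually_elim
    case (elim x)
    then show ?case using acip_measure_total_pos[OF \<eta>] invariant_density_pos[of \<eta> x] \<eta>
      by (auto simp: ennreal_zero_less_mult_iff)
  qed
  show ?thesis
    unfolding acip_measure_def AE_density[OF borel_measurable_density_leb]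
  proof
    assume "AE x in leb. 0 < ennreal (1 / suminf (mass_term \<eta> {-1..1})) * invariant_density \<eta> x \<longrightarrow> P x"
    with pos show "AE x in leb. P x" by eventually_elim blast
  qed (auto elim: eventually_mono)
qed

lemma \<mu>_eq_acip_measure:
  assumes \<eta>: "1 < \<eta>" "\<eta> \<le> 2"
  shows "\<mu> \<eta> = acip_measure \<eta>"
proof -
  let ?M = "acip_measure \<eta>"
  interpret ergodic_map ?M "S \<eta>" by (rule acip_measure_ergodic[OF \<eta>])
  have sl: "sets leb = sets (restrict_space borel {-1..1})"
    unfolding leb_def by (intro sets_restrict_space_cong) auto
  have lM: "absolutely_continuous ?M leb"
    unfolding absolutely_continuous_def
  proof
    fix N assume "N \<in> null_sets ?M"
    then show "N \<in> null_sets leb"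
      using AE_acip_measure_iff[OF \<eta>, of "\<lambda>x. x \<notin> N"] AE_iff_null_sets[of N ?M] AE_iff_null_sets[of N leb]
      by (auto simp: sets_acip_measure)
  qed
  have "acip \<eta> ?M"
    unfolding acip_def
  proof (intro conjI ballI)
    show "absolutely_continuous leb ?M"
      unfolding acip_measure_def by (rule absolutely_continuousI_density) measurable
    show "emeasure ?M (S \<eta> -` A \<inter> space ?M) = emeasure ?M A" if "A \<in> sets ?M" for A
      using emeasure_distr[OF T that] by (simp add: invariant)
  qed (auto simp: sets_acip_measure sl prob_space_axioms)
  moreover have "N = ?M" if "acip \<eta> N" for N
  proof (rule absolutely_continuous_invariant_unique)
    have N: "sets N = sets leb" "prob_space N" "absolutely_continuous leb N"
      "\<And>A. A \<in> sets N \<Longrightarrow> emeasure N (S \<eta> -` A \<inter> space N) = emeasure N A"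
      using that by (auto simp: acip_def sl)
    show "sets N = sets ?M" using N(1) by (simp add: sets_acip_measure)
    show "absolutely_continuous ?M N"
      using N(3) lM by (auto simp: absolutely_continuous_def)
    have T': "S \<eta> \<in> measurable N N"
      using S_measurable_leb[of \<eta>] \<eta> N(1) by (simp cong: measurable_cong_sets)
    have "distr N N (S \<eta>) = N"
      by (rule measure_eqI) (auto simp: emeasure_distr[OF T'] N(4))
    then show "measure_preserving_map N (S \<eta>)"
      using N(2) T' by (simp add: measure_preserving_map_def measure_preserving_map_axioms_def)
  qed
  ultimately have "(THE M. acip \<eta> M) = ?M" by (rule the_equality)
  then show ?thesis using \<eta> by (simp add: \<mu>_def)
qed

section \<open>The excess over two thirds\<close>

text \<open>
  The \<open>n\<close>-th contribution, before normalisation, to the excess of the mass of \<open>[-1/2,1/2]\<close> over \<open>2/3\<close> of the total.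
\<close>

definition digit_gain :: "real \<Rightarrow> nat \<Rightarrow> real" where
  "digit_gain \<eta> n = mass_term \<eta> {-1/2..1/2} n - 2/3 * mass_term \<eta> {-1..1} n"

text \<open>
  For \<open>\<eta> \<le> 3/2\<close>, an upper bound for the excess still to come from the pair \<open>(u,v)\<close>, in units of the current
  weight \<open>(1/2)^n\<close>; exact if \<open>min u (- v)\<close> never drops below \<open>\<eta> / 6\<close> before coalescence. It is found by solving for a function of \<open>min u (- v)\<close>, constant
  above the fixed point \<open>\<eta> / 3\<close> of the tent map and affine below it, that reproduces one step of the series.
\<close>

definition potential :: "real \<Rightarrow> real \<Rightarrow> real \<Rightarrow> real" where
  "potential \<eta> u v = (if v = u then 0
     else if min u (- v) \<le> \<eta> / 3 then 2 * (min u (- v) - (\<eta> - 1)) else 2 * (1 - 2 * \<eta> / 3))"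

lemma digit_gain_eq:
  assumes "1 \<le> \<eta>" "\<eta> \<le> 2"
  shows "digit_gain \<eta> n = (1/2) ^ n * (2 * (max (-1/2) (min (1/2) (upper_orbit \<eta> n))
      - max (-1/2) (min (1/2) (lower_orbit \<eta> n))) - 4/3 * (upper_orbit \<eta> n - lower_orbit \<eta> n))"
proof -
  have "signed_mass {-1/2..1/2} t = 2 * max (-1/2) (min (1/2) t)" "signed_mass {-1..1} t = 2 * t"
    if "t \<in> {-1..1}" for t
    using signed_mass_interval[of "1/2" t] signed_mass_interval[of 1 t] that by auto
  then show ?thesis
    using critical_orbits_range[OF assms, of n]
    by (simp add: digit_gain_def mass_term_def algebra_simps)
qed

text \<open>
  With \<open>s = min u (- v)\<close>: for \<open>s > 1/2\<close> the pair coalesces; for \<open>\<eta> / 3 < s \<le> 1/2\<close> the next value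
  \<open>\<eta> - 2 * s\<close> is below \<open>\<eta> / 3\<close>; for \<open>\<eta> / 6 \<le> s \<le> \<eta> / 3\<close> the next value is at least \<open>\<eta> / 3\<close>. In these
  cases the step is exact. For \<open>s < \<eta> / 6\<close> the next value \<open>2 * s\<close> is still below \<open>\<eta> / 3\<close>, where the
  potential is smaller than the constant for which equality would hold, and the inequality is strict.
\<close>

lemma potential_step:
  assumes \<eta>: "1 < \<eta>" "\<eta> \<le> 3/2" and r: "u \<in> {-1..1}" "v \<in> {-1..1}" and uv: "v = u \<or> v = u - \<eta>"
  defines "g \<equiv> 2 * (max (-1/2) (min (1/2) u) - max (-1/2) (min (1/2) v)) - 4/3 * (u - v)"
    and "p \<equiv> potential \<eta> u v - potential \<eta> (S \<eta> u) (S \<eta> v) / 2"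
  shows "g \<le> p" and "v = u \<or> \<eta> / 6 \<le> min u (- v) \<Longrightarrow> g = p"
    and "v \<noteq> u \<Longrightarrow> min u (- v) < \<eta> / 6 \<Longrightarrow> g < p"
proof -
  have "g \<le> p \<and> (v = u \<or> \<eta> / 6 \<le> min u (- v) \<longrightarrow> g = p) \<and> (v \<noteq> u \<longrightarrow> min u (- v) < \<eta> / 6 \<longrightarrow> g < p)"
  proof (cases "v = u")
    case False
    then have v: "v = u - \<eta>" using uv by simp
    consider (stop) "u > 1/2" "v < -1/2" | (up) "u > 1/2" "v \<ge> -1/2" | (down) "u \<le> 1/2" "v < -1/2"
      using v \<eta> by linarith
    then show ?thesis
    proof cases
      case stop
      then have "S \<eta> u = 2 * u - \<eta>" "S \<eta> v = 2 * v + \<eta>" by (auto simp: S_left S_right)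
      then show ?thesis using stop \<eta> r unfolding g_def p_def potential_def v
        by (auto simp: max_def min_def field_simps)
    next
      case up
      have "\<bar>v\<bar> \<le> 1/2" using up v r \<eta> by auto
      with up have "S \<eta> u = 2 * u - \<eta>" "S \<eta> v = 2 * v" by (auto simp: S_mid S_right)
      then show ?thesis using up \<eta> r unfolding g_def p_def potential_def v
        by (auto simp: max_def min_def field_simps)
    next
      case down
      have "\<bar>u\<bar> \<le> 1/2" using down v r \<eta> by auto
      with down have "S \<eta> u = 2 * u" "S \<eta> v = 2 * v + \<eta>" by (auto simp: S_mid S_left)
      then show ?thesis using down \<eta> r unfolding g_def p_def potential_def v
        by (auto simp: max_def min_def field_simps)
    qed
  qed (simp add: g_def p_def potential_def)
  then show "g \<le> p" "v = u \<or> \<eta> / 6 \<le> min u (- v) \<Longrightarrow> g = p"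
    "v \<noteq> u \<Longrightarrow> min u (- v) < \<eta> / 6 \<Longrightarrow> g < p" by blast+
qed

lemma abs_potential_le:
  assumes \<eta>: "1 < \<eta>" "\<eta> \<le> 3/2" and r: "u \<in> {-1..1}" "v \<in> {-1..1}" and uv: "v = u \<or> v = u - \<eta>"
  shows "\<bar>potential \<eta> u v\<bar> \<le> 2"
proof (cases "v = u")
  case False
  define m where "m = min u (- v)"
  have m: "\<eta> - 1 \<le> m" using False uv r by (auto simp: m_def)
  show ?thesis
  proof (cases "m \<le> \<eta> / 3")
    case True
    then have "potential \<eta> u v = 2 * (m - (\<eta> - 1))" using False by (simp add: potential_def m_def)
    then show ?thesis using m True \<eta> by simp
  next
    case gt: False
    then have "potential \<eta> u v = 2 * (1 - 2 * \<eta> / 3)" using False by (simp add: potential_def m_def)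
    then show ?thesis using \<eta> by simp
  qed
qed (simp add: potential_def)

text \<open>
  The potential telescopes from \<open>0\<close> to \<open>0\<close>, so the sum of the gains is minus the sum of the losses. Before coalescence
  \<open>min u (- v)\<close> is at least \<open>\<eta> - 1\<close>, since both orbits stay in \<open>[-1,1]\<close>, and it starts at
  \<open>\<eta> - 1\<close>; so a loss occurs if and only if \<open>\<eta> - 1 < \<eta> / 6\<close>.
\<close>

lemma digit_gain_suminf:
  assumes \<eta>: "1 < \<eta>" "\<eta> \<le> 2"
  shows "suminf (digit_gain \<eta>) \<le> 0 \<and> (suminf (digit_gain \<eta>) = 0 \<longleftrightarrow> \<eta> \<in> {6/5..3/2})"
proof (cases "\<eta> \<le> 3/2")
  case False
  have "upper_orbit \<eta> (Suc n) = lower_orbit \<eta> (Suc n)" for n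
  proof (induction n)
    case 0
    show ?case using False \<eta> by (simp add: S_right S_left)
  qed simp
  then have "digit_gain \<eta> n = 0" if "n \<noteq> 0" for n
    using that by (cases n) (auto simp: digit_gain_def mass_term_def simp del: funpow.simps)
  then have "suminf (digit_gain \<eta>) = digit_gain \<eta> 0"
    using suminf_finite[of "{0}" "digit_gain \<eta>"] by auto
  also have "\<dots> = 2 * (1 - 2 * \<eta> / 3)" using False \<eta> by (simp add: digit_gain_eq)
  finally show ?thesis using False by auto
next
  case True
  let ?u = "upper_orbit \<eta>" and ?v = "lower_orbit \<eta>"
  define P where "P n = potential \<eta> (?u n) (?v n)" for n
  define loss where "loss n = (1/2) ^ n * P n - (1/2) ^ Suc n * P (Suc n) - digit_gain \<eta> n" for n
  have r: "?u n \<in> {-1..1}" "?v n \<in> {-1..1}" for n using critical_orbits_range \<eta> by auto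
  define g where "g n = 2 * (max (-1/2) (min (1/2) (?u n)) - max (-1/2) (min (1/2) (?v n))) - 4/3 * (?u n - ?v n)" for n
  have step: "g n \<le> P n - P (Suc n) / 2"
    "?v n = ?u n \<or> \<eta> / 6 \<le> min (?u n) (- ?v n) \<Longrightarrow> g n = P n - P (Suc n) / 2"
    "?v n \<noteq> ?u n \<Longrightarrow> min (?u n) (- ?v n) < \<eta> / 6 \<Longrightarrow> g n < P n - P (Suc n) / 2" for n
    unfolding g_def P_def funpow.simps comp_def
    by (fact potential_step[OF \<eta>(1) True r(1) r(2) critical_orbits_gap[OF \<eta>]])+
  have loss_eq: "loss n = (1/2) ^ n * ((P n - P (Suc n) / 2) - g n)" for n
    unfolding loss_def digit_gain_eq[OF less_imp_le[OF \<eta>(1)] \<eta>(2)] power_Suc g_def[symmetric]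
    by (simp add: algebra_simps)
  have loss_nonneg: "loss n \<ge> 0" for n
    unfolding loss_eq using step(1)[of n] by simp
  have Pb: "\<bar>P n\<bar> \<le> 2" for n
    unfolding P_def by (rule abs_potential_le[OF \<eta>(1) True r critical_orbits_gap[OF \<eta>]])
  have "(\<lambda>n. (1/2) ^ n * P n) \<longlonglongrightarrow> 0"
  proof (rule Lim_null_comparison)
    show "\<forall>\<^sub>F n in sequentially. norm ((1/2) ^ n * P n) \<le> (1/2) ^ n * 2"
      using Pb by (intro always_eventually allI) (simp add: abs_mult)
    show "(\<lambda>n. (1/2) ^ n * 2 :: real) \<longlonglongrightarrow> 0"
      by (rule tendsto_mult_left_zero[OF LIMSEQ_realpow_zero]) auto
  qed
  then have "(\<lambda>n. (1/2) ^ n * P n - (1/2) ^ Suc n * P (Suc n)) sums ((1/2) ^ 0 * P 0 - 0)"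
    by (rule telescope_sums')
  moreover have "P 0 = 0" using True \<eta> by (simp add: P_def potential_def min_def)
  ultimately have tele: "(\<lambda>n. (1/2) ^ n * P n - (1/2) ^ Suc n * P (Suc n)) sums 0" by simp
  have dg: "summable (digit_gain \<eta>)" unfolding digit_gain_def[abs_def]
    using \<eta> by (intro summable_diff summable_mult summable_mass_term) auto
  have sl: "summable loss" unfolding loss_def[abs_def]
    by (intro summable_diff[OF _ dg] sums_summable[OF tele])
  have "suminf loss = 0 - suminf (digit_gain \<eta>)"
    unfolding loss_def[abs_def] using suminf_diff[OF sums_summable[OF tele] dg] sums_unique[OF tele] by simp
  then have eq: "suminf (digit_gain \<eta>) = - suminf loss" by simp
  have "suminf loss = 0 \<longleftrightarrow> (\<forall>n. loss n = 0)"
    using suminf_eq_zero_iff[OF sl] loss_nonneg by auto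
  also have "\<dots> \<longleftrightarrow> 6/5 \<le> \<eta>"
  proof
    assume "\<forall>n. loss n = 0"
    then have "loss 0 = 0" by blast
    then have "\<not> (?v 0 \<noteq> ?u 0 \<and> min (?u 0) (- ?v 0) < \<eta> / 6)"
      using step(3)[of 0] unfolding loss_eq by auto
    then show "6/5 \<le> \<eta>" using \<eta> by auto
  next
    assume *: "6/5 \<le> \<eta>"
    show "\<forall>n. loss n = 0"
    proof
      fix n
      have "?v n = ?u n \<or> \<eta> / 6 \<le> min (?u n) (- ?v n)"
        using r[of n] critical_orbits_gap[OF \<eta>, of n] * by auto
      from step(2)[OF this] show "loss n = 0" unfolding loss_eq by simp
    qed
  qed
  finally show ?thesis using eq True suminf_nonneg[OF sl loss_nonneg] by auto
qed

section \<open>The frequency of the digit zero\<close>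

lemma d1_eq_0_iff: "d1 x = 0 \<longleftrightarrow> x \<in> {-1/2..1/2}"
  by (auto simp: d1_def)

lemma zero_freq_eq_orbit_average:
  "zero_freq \<eta> x N = (\<Sum>k<N. indicator {-1/2..1/2} ((S \<eta> ^^ k) x)) / N"
proof -
  have "{n \<in> {1..N}. digit \<eta> n x = 0} = Suc ` {k \<in> {..<N}. (S \<eta> ^^ k) x \<in> {-1/2..1/2}}"
    unfolding digit_def d1_eq_0_iff
  proof (intro set_eqI iffI)
    fix n assume "n \<in> {n \<in> {1..N}. (S \<eta> ^^ (n - 1)) x \<in> {-1/2..1/2}}"
    then show "n \<in> Suc ` {k \<in> {..<N}. (S \<eta> ^^ k) x \<in> {-1/2..1/2}}"
      by (intro image_eqI[of _ _ "n - 1"]) auto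
  qed auto
  then have "card {n \<in> {1..N}. digit \<eta> n x = 0} = card {k \<in> {..<N}. (S \<eta> ^^ k) x \<in> {-1/2..1/2}}"
    by (simp add: card_image)
  also have "real \<dots> = (\<Sum>k<N. indicator {-1/2..1/2} ((S \<eta> ^^ k) x))"
    by (simp add: indicator_def sum.If_cases Int_def flip: of_bool_def)
  finally show ?thesis by (simp add: zero_freq_def)
qed

lemma zero_freq_minus: "zero_freq \<eta> (- x) N = zero_freq \<eta> x N"
proof -
  have "(S \<eta> ^^ k) (- x) = - (S \<eta> ^^ k) x" for k
    by (induction k) (auto simp: S_minus)
  moreover have "indicator {-1/2..1/2} (- y) = (indicator {-1/2..1/2} y :: real)" for y :: real
    by (auto simp: indicator_def)
  ultimately show ?thesis by (simp add: zero_freq_eq_orbit_average)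
qed

lemma ergodic_zero_freq:
  assumes "ergodic_map M (S \<eta>)" "{-1/2..1/2} \<in> sets M"
  shows "AE x in M. zero_freq \<eta> x \<longlonglongrightarrow> measure M {-1/2..1/2}"
proof -
  interpret ergodic_map M "S \<eta>" by (rule assms(1))
  have "AE x in M. (\<lambda>N. (\<Sum>k<N. indicator {-1/2..1/2} ((S \<eta> ^^ k) x)) / N)
      \<longlonglongrightarrow> (\<integral>x. indicator {-1/2..1/2} x \<partial>M)"
  proof (rule orbit_averages_converge)
    show "indicator {-1/2..1/2} \<in> borel_measurable M"
      by (rule borel_measurable_indicator[OF assms(2)])
    show "\<bar>indicator {-1/2..1/2} x\<bar> \<le> (1::real)" for x :: real by (simp add: indicator_def)
  qed
  moreover have "(\<integral>x. indicator {-1/2..1/2} x \<partial>M) = measure M {-1/2..1/2}"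
    using assms(2) sets.sets_into_space[OF assms(2)] by (simp add: Int_absorb1 Int_absorb2)
  ultimately show ?thesis by (simp add: zero_freq_eq_orbit_average[abs_def])
qed

lemma doubling_unit_interval_ergodic: "ergodic_map (uniform_measure lborel {0<..1}) (S 1)"
proof -
  let ?M = "uniform_measure lborel {0<..1::real}"
  interpret prob_space ?M by (rule prob_space_uniform_measure) auto
  have em: "emeasure ?M B = emeasure lborel (B \<inter> {0<..1})" if "B \<in> sets borel" for B
    using that by (simp add: emeasure_uniform_measure Int_commute divide_ennreal_def)
  have me: "measure ?M B = measure lborel (B \<inter> {0<..1})" if "B \<in> sets borel" for B
    using em[OF that] by (simp add: measure_def)
  have T: "S 1 \<in> measurable ?M ?M" by simp
  show ?thesis
  proof unfold_locales
    show "S 1 \<in> measurable ?M ?M" by (rule T)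
    show "distr ?M ?M (S 1) = ?M"
    proof (rule measure_eqI)
      fix B assume "B \<in> sets (distr ?M ?M (S 1))"
      then have B: "B \<in> sets borel" by simp
      have C: "S 1 -` B \<in> sets borel" using measurable_sets[OF borel_measurable_S B] by simp
      have "measure lborel (S 1 -` B \<inter> {0<..1}) =
          measure lborel (S 1 -` B \<inter> {0<..1/2}) + measure lborel (S 1 -` B \<inter> {1/2<..1})"
        by (rule measure_Ioc_split[OF C]) auto
      also have "measure lborel (S 1 -` B \<inter> {0<..1/2}) = measure lborel (B \<inter> {2 * 0 + 0<..2 * (1/2) + 0}) / 2"
        by (rule measure_branch[OF C B]) (auto simp: S_mid)
      also have "measure lborel (S 1 -` B \<inter> {1/2<..1}) = measure lborel (B \<inter> {2 * (1/2) + - 1<..2 * 1 + - 1}) / 2"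
        by (rule measure_branch[OF C B]) (auto simp: S_right)
      finally have "measure lborel (S 1 -` B \<inter> {0<..1}) = measure lborel (B \<inter> {0<..1})" by simp
      then have "measure ?M (S 1 -` B) = measure ?M B" using me B C by simp
      then show "emeasure (distr ?M ?M (S 1)) B = emeasure ?M B"
        using B by (simp add: emeasure_distr[OF T] emeasure_eq_measure)
    qed simp
    fix A assume A: "A \<in> sets ?M" "S 1 -` A \<inter> space ?M = A"
    have A': "A \<inter> {0<..1} \<in> sets borel" "A \<inter> {0<..1} \<subseteq> {0<..1}" using A(1) by auto
    have "A \<inter> {0<..1} \<in> null_sets lborel \<or> {0<..1} - A \<inter> {0<..1} \<in> null_sets lborel"
    proof (rule S1_ergodic[OF A'])
      fix x :: real assume x: "x \<in> {0<..1}"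
      then have "S 1 x \<in> {0<..1}" by (auto simp: S_def d1_def)
      then show "S 1 x \<in> A \<inter> {0<..1} \<longleftrightarrow> x \<in> A \<inter> {0<..1}" using A(2) x by auto
    qed
    then show "emeasure ?M A = 0 \<or> emeasure ?M A = 1"
    proof
      assume "A \<inter> {0<..1} \<in> null_sets lborel"
      then show ?thesis using em[of A] A(1) by auto
    next
      assume *: "{0<..1} - A \<inter> {0<..1} \<in> null_sets lborel"
      have "(space ?M - A) \<inter> {0<..1} = {0<..1} - A \<inter> {0<..1}" by auto
      then have "prob (space ?M - A) = 0"
        using me[of "space ?M - A"] A(1) * by (simp add: measure_def null_sets_def)
      then show ?thesis using prob_compl[OF A(1)] by (simp add: emeasure_eq_measure)
    qed
  qed
qed

text \<open>
  The doubling map on \<open>(0,1]\<close> gives the frequency there; since \<open>S 1\<close> is odd, \<open>x\<close> and \<open>-x\<close> have opposite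
  digits and the same zeros.
\<close>

lemma zero_freq_at_1: "AE x in leb. zero_freq 1 x \<longlonglongrightarrow> 1/2"
proof -
  let ?P = "\<lambda>x. zero_freq 1 x \<longlonglongrightarrow> 1/2"
  have "AE x in uniform_measure lborel {0<..1}. zero_freq 1 x \<longlonglongrightarrow> measure (uniform_measure lborel {0<..1}) {-1/2..1/2::real}"
    by (rule ergodic_zero_freq[OF doubling_unit_interval_ergodic]) simp
  moreover have "measure (uniform_measure lborel {0<..1::real}) {-1/2..1/2} = 1/2"
  proof -
    have "{0<..1} \<inter> {-1/2..1/2} = {0<..1/2::real}" by auto
    then show ?thesis by (simp add: measure_uniform_measure)
  qed
  ultimately have "AE x in uniform_measure lborel {0<..1}. ?P x" by (simp only:)
  then have "AE x in lborel. x \<in> {0<..1} \<longrightarrow> ?P x"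
    by (subst (asm) AE_uniform_measure) auto
  then obtain N where N: "{x. \<not> (x \<in> {0<..1} \<longrightarrow> ?P x)} \<subseteq> N" "N \<in> null_sets lborel"
    by (auto elim!: AE_E simp: null_sets_def)
  have 1: "AE x in lborel. x \<notin> N" by (rule AE_not_in[OF N(2)])
  have 2: "AE x in lborel. 0 + (-1) * x \<notin> N"
    by (rule AE_borel_affine[OF _ _ 1]) (use N(2) in auto)
  show ?thesis
    unfolding AE_leb using 1 2 AE_lborel_singleton[of "0::real"]
  proof eventually_elim
    case (elim x)
    have "?P x \<longleftrightarrow> ?P (- x)" by (simp add: zero_freq_minus[abs_def])
    moreover have "?P y" if "y \<in> {0<..1}" "y \<notin> N" for y using that N(1) by blast
    note this[of x] this[of "- x"]
    ultimately show ?case using elim by (cases "x > 0") auto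
  qed
qed

lemma not_AE_leb_False: "\<not> (AE x in leb. False)"
proof
  assume "AE x in leb. False"
  then have "AE x in lborel. x \<notin> {-1..1::real}" by (simp add: AE_leb)
  then have "{-1..1::real} \<in> null_sets lborel"
    by (subst (asm) AE_iff_null_sets[symmetric]) auto
  then show False by (auto simp: null_sets_def)
qed

lemma \<mu>_zero_digit:
  assumes "\<eta> \<in> {1..2}"
  shows "measure (\<mu> \<eta>) {-1/2..1/2} \<le> 2/3"
    and "measure (\<mu> \<eta>) {-1/2..1/2} = 2/3 \<longleftrightarrow> \<eta> \<in> {6/5..3/2}"
    and "AE x in leb. zero_freq \<eta> x \<longlonglongrightarrow> measure (\<mu> \<eta>) {-1/2..1/2}"
proof -
  have "measure (\<mu> \<eta>) {-1/2..1/2} \<le> 2/3 \<and> (measure (\<mu> \<eta>) {-1/2..1/2} = 2/3 \<longleftrightarrow> \<eta> \<in> {6/5..3/2})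
    \<and> (AE x in leb. zero_freq \<eta> x \<longlonglongrightarrow> measure (\<mu> \<eta>) {-1/2..1/2})"
  proof (cases "\<eta> = 1")
    case True
    have e: "emeasure leb B = emeasure lborel B" if "B \<in> sets borel" "B \<subseteq> {-1..1}" for B
      unfolding leb_def by (rule emeasure_restrict_space) (use that in auto)
    have half: "measure (\<mu> 1) {-1/2..1/2} = 1/2"
    proof -
      have "measure leb {-1..1} = 2" "measure leb {-1/2..1/2} = 1"
        using e[of "{-1..1}"] e[of "{-1/2..1/2}"] by (simp_all add: measure_def)
      moreover have "{-1..1} \<inter> {-1/2..1/2} = {-1/2..1/2::real}" by auto
      ultimately show ?thesis
        unfolding \<mu>_def using e[of "{-1..1}"]
        by (simp add: measure_uniform_measure sets_leb)
    qed
    show ?thesis unfolding True half using zero_freq_at_1 by simp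
  next
    case False
    then have \<eta>: "1 < \<eta>" "\<eta> \<le> 2" using assms by auto
    let ?Z = "suminf (mass_term \<eta> {-1..1})" and ?H = "suminf (mass_term \<eta> {-1/2..1/2})"
    note Z = acip_measure_total_pos[OF \<eta>]
    have sm: "summable (mass_term \<eta> {-1/2..1/2})" "summable (mass_term \<eta> {-1..1})"
      using summable_mass_term \<eta> by auto
    have H: "0 \<le> ?H" by (rule suminf_nonneg[OF sm(1)]) (use nn_integral_layer(2)[OF \<eta>] in auto)
    have m: "measure (acip_measure \<eta>) {-1/2..1/2} = ?H / ?Z"
      using emeasure_acip_measure[OF \<eta>, of "{-1/2..1/2}"] H Z by (simp add: measure_def)
    have gain: "suminf (digit_gain \<eta>) = ?H - 2/3 * ?Z"
      unfolding digit_gain_def[abs_def]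
      by (subst suminf_mult[OF sm(2), symmetric]) (rule suminf_diff[OF sm(1) summable_mult[OF sm(2)], symmetric])
    have "?H / ?Z \<le> 2/3 \<longleftrightarrow> suminf (digit_gain \<eta>) \<le> 0" "?H / ?Z = 2/3 \<longleftrightarrow> suminf (digit_gain \<eta>) = 0"
      unfolding gain using Z by (auto simp: field_simps)
    then have "?H / ?Z \<le> 2/3 \<and> (?H / ?Z = 2/3 \<longleftrightarrow> \<eta> \<in> {6/5..3/2})"
      using digit_gain_suminf[OF \<eta>] by simp
    moreover have "AE x in leb. zero_freq \<eta> x \<longlonglongrightarrow> measure (acip_measure \<eta>) {-1/2..1/2}"
      using ergodic_zero_freq[OF acip_measure_ergodic[OF \<eta>]]
      by (simp add: AE_acip_measure_iff[OF \<eta>] sets_acip_measure sets_leb)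
    ultimately show ?thesis unfolding \<mu>_eq_acip_measure[OF \<eta>] m by blast
  qed
  then show "measure (\<mu> \<eta>) {-1/2..1/2} \<le> 2/3"
    "measure (\<mu> \<eta>) {-1/2..1/2} = 2/3 \<longleftrightarrow> \<eta> \<in> {6/5..3/2}"
    "AE x in leb. zero_freq \<eta> x \<longlonglongrightarrow> measure (\<mu> \<eta>) {-1/2..1/2}" by blast+
qed

theorem theorem3:
  fixes \<eta> :: real
  assumes "\<eta> \<in> {1..2}"
  shows "(measure (\<mu> \<eta>) {-1/2..1/2} \<le> 2/3 \<and>
          (measure (\<mu> \<eta>) {-1/2..1/2} = 2/3 \<longleftrightarrow> \<eta> \<in> {6/5..3/2})) \<and>
         (AE x in leb. zero_freq \<eta> x \<longlonglongrightarrow> measure (\<mu> \<eta>) {-1/2..1/2}) \<and>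
         (AE x in leb. \<exists>L. zero_freq \<eta> x \<longlonglongrightarrow> L \<and> L \<le> 2/3) \<and>
         ((AE x in leb. zero_freq \<eta> x \<longlonglongrightarrow> 2/3) \<longleftrightarrow> \<eta> \<in> {6/5..3/2})"
proof -
  note facts = \<mu>_zero_digit[OF assms]
  have "AE x in leb. \<exists>L. zero_freq \<eta> x \<longlonglongrightarrow> L \<and> L \<le> 2/3"
    using facts(3) by eventually_elim (use facts(1) in blast)
  moreover have "(AE x in leb. zero_freq \<eta> x \<longlonglongrightarrow> 2/3) \<longleftrightarrow> measure (\<mu> \<eta>) {-1/2..1/2} = 2/3"
  proof
    assume "AE x in leb. zero_freq \<eta> x \<longlonglongrightarrow> 2/3"
    with facts(3) have "AE x in leb. measure (\<mu> \<eta>) {-1/2..1/2} = 2/3"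
      by eventually_elim (rule LIMSEQ_unique)
    then show "measure (\<mu> \<eta>) {-1/2..1/2} = 2/3"
      using not_AE_leb_False by (cases "measure (\<mu> \<eta>) {-1/2..1/2} = 2/3") auto
  next
    assume max: "measure (\<mu> \<eta>) {-1/2..1/2} = 2/3"
    show "AE x in leb. zero_freq \<eta> x \<longlonglongrightarrow> 2/3" using facts(3) unfolding max .
  qed
  ultimately show ?thesis using facts by blast
qed

end
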